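(* Let $p,q$ be primes such that $q$ divides $(p^p-1)/(p-1)$, and let $n=p^pq$. Let $N$ and the subgroup $G=\langle X,Y_{e_{p-1}},Z\rangle$ of $\mathrm{Hol}(N)$ be as defined in the context. Then, under the correspondence between regular subgroups of $\mathrm{Hol}(N)$ and skew braces with additive group $N$, the subgroup $G$ gives a simple skew brace $(B,\cdot,\circ)$ of order $n$ with $(B,\cdot)\cong N$ and $(B,\circ)\cong G$.
   Context: Skew braces: a skew brace $(B,\cdot,\circ)$ is a set with two group operations satisfying $a\circ(b\cdot c)=(a\circ b)\cdot a^{-1}\cdot(a\circ c)$, with $a^{-1}$ the inverse in $(B,\cdot)$; its order is $|B|$. Put $\lambda_a(b)=a^{-1}\cdot(a\circ b)$. An ideal is a subgroup $I$ of $(B,\cdot)$ with $\lambda_a(I)\subseteq I$ for all $a\in B$ which is normal in both $(B,\cdot)$ and $(B,\circ)$. $B$ is simple if $|B|>1$ and its only ideals are $\{1\}$ and $B$. Holomorph: for a group $N$, $\mathrm{Hol}(N)=N\rtimes\mathrm{Aut}(N)$ acts on the set $N$ by $(\eta,\alpha)\mu=\eta\alpha(\mu)$, with multiplication $(\eta,\alpha)(\mu,\beta)=(\eta\alpha(\mu),\alpha\beta)$. A subgroup $G$ is regular if for all $\eta,\mu\in N$ there is a unique $g\in G$ with $g\eta=\mu$. A regular $G$ contains, for each $\eta\in N$, a unique element $g_\eta$ with first component $\eta$, and gives the skew brace $(N,\cdot,\circ)$ where $\circ$ is defined by $g_{\eta\circ\eta'}=g_\eta g_{\eta'}$. Notation: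 $V=\mathbb{F}_p^p$ (column vectors) with standard basis $e_1,\dots,e_p$. $J\in\mathrm{GL}_p(\mathbb{F}_p)$ is the Jordan matrix with $Je_1=e_1$ and $Je_i=e_i+e_{i-1}$ for $2\le i\le p$. $M\in\mathrm{GL}_p(\mathbb{F}_p)$ is a fixed matrix of order $q$ with $JMJ^{-1}=M^p$ (such an $M$ exists). $N$ is the group, of order $p^pq$, of block matrices $\begin{pmatrix}M^k&v\\0&1\end{pmatrix}\in\mathrm{GL}_{p+1}(\mathbb{F}_p)$ with $0\le k\le q-1$, $v\in V$. If $A\in\mathrm{GL}_p(\mathbb{F}_p)$ normalises $\langle M\rangle$ and $w\in V$, then conjugation by $S=\begin{pmatrix}A&w\\0&1\end{pmatrix}$ is an automorphism $\mathrm{conj}(S)$ of $N$. Elements of $\mathrm{Hol}(N)$ are written $[R,\mathrm{conj}(S)]$ with $R\in N$. Define $$X=\left[\begin{pmatrix}M&0\\0&1\end{pmatrix},\mathrm{conj}\begin{pmatrix}I&0\\0&1\end{pmatrix}\right],\quad Y_v=\left[\begin{pmatrix}I&v\\0&1\end{pmatrix},\mathrm{conj}\begin{pmatrix}I&-v\\0&1\end{pmatrix}\right]\ (v\in V),$$ $$Z=\left[\begin{pmatrix}I&e_p\\0&1\end{pmatrix},\mathrm{conj}\begin{pmatrix}J&-e_p\\0&1\end{pmatrix}\right],$$ and $G=\langle X,Y_{e_{p-1}},Z\rangle\le\mathrm{Hol}(N)$, which is a regular subgroup of $\mathrm{Hol}(N)$. *)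

theory Defs
  imports
    "HOL-Algebra.Generated_Groups"
    "HOL-Algebra.Multiplicative_Group"
    "HOL-Algebra.Bij"
    "Berlekamp_Zassenhaus.Finite_Field"
    "Jordan_Normal_Form.Jordan_Normal_Form"
begin

section \<open>Skew braces\<close>

text \<open>
  As a \<^const>\<open>ring\<close> extends its multiplicative monoid, a brace structure \<open>B\<close> extends its additive
  group \<open>(B, \<cdot>)\<close>, which is \<open>B\<close> itself; the circle group is \<open>circ_group B\<close>.
\<close>

record 'a brace = "'a monoid" +
  circ :: "'a \<Rightarrow> 'a \<Rightarrow> 'a"
  circ_one :: 'a

definition circ_group :: "('a, 'b) brace_scheme \<Rightarrow> 'a monoid" where
  "circ_group B = \<lparr>carrier = carrier B, monoid.mult = circ B, one = circ_one B\<rparr>"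

locale skew_brace = group B + circle: group "circ_group B" for B :: "('a, 'b) brace_scheme" (structure) +
  assumes brace_law:
    "\<lbrakk>a \<in> carrier B; b \<in> carrier B; c \<in> carrier B\<rbrakk>
      \<Longrightarrow> circ B a (b \<otimes> c) = circ B a b \<otimes> inv a \<otimes> circ B a c"

definition brace_lambda :: "('a, 'b) brace_scheme \<Rightarrow> 'a \<Rightarrow> 'a \<Rightarrow> 'a" where
  "brace_lambda B a b = inv\<^bsub>B\<^esub> a \<otimes>\<^bsub>B\<^esub> circ B a b"

definition brace_ideal :: "'a set \<Rightarrow> ('a, 'b) brace_scheme \<Rightarrow> bool" where
  "brace_ideal I B \<longleftrightarrow>
     subgroup I B \<and> (\<forall>a\<in>carrier B. brace_lambda B a ` I \<subseteq> I) \<and> I \<lhd> B \<and> I \<lhd> circ_group B"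

text \<open>The condition \<open>carrier B \<noteq> {\<one>}\<close> says \<open>|B| > 1\<close> also for infinite \<open>B\<close>, where \<^const>\<open>card\<close> is 0.\<close>

definition simple_skew_brace :: "('a, 'b) brace_scheme \<Rightarrow> bool" where
  "simple_skew_brace B \<longleftrightarrow>
     skew_brace B \<and> carrier B \<noteq> {\<one>\<^bsub>B\<^esub>} \<and>
     (\<forall>I. brace_ideal I B \<longrightarrow> I = {\<one>\<^bsub>B\<^esub>} \<or> I = carrier B)"


section \<open>Regular subgroups of the holomorph\<close>

text \<open>
  Elements of \<^term>\<open>AutoGroup N\<close> are extensional functions on \<^term>\<open>carrier N\<close>, so that each
  automorphism is represented exactly once.
\<close>

definition Hol :: "('a, 'b) monoid_scheme \<Rightarrow> ('a \<times> ('a \<Rightarrow> 'a)) monoid" where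
  "Hol N = \<lparr>carrier = carrier N \<times> carrier (AutoGroup N),
            monoid.mult = (\<lambda>(\<eta>, \<alpha>) (\<mu>, \<beta>). (\<eta> \<otimes>\<^bsub>N\<^esub> \<alpha> \<mu>, \<alpha> \<otimes>\<^bsub>AutoGroup N\<^esub> \<beta>)),
            one = (\<one>\<^bsub>N\<^esub>, \<one>\<^bsub>AutoGroup N\<^esub>)\<rparr>"

definition hol_act :: "('a, 'b) monoid_scheme \<Rightarrow> 'a \<times> ('a \<Rightarrow> 'a) \<Rightarrow> 'a \<Rightarrow> 'a" where
  "hol_act N = (\<lambda>(\<eta>, \<alpha>) \<mu>. \<eta> \<otimes>\<^bsub>N\<^esub> \<alpha> \<mu>)"

definition regular_subgroup :: "('a \<times> ('a \<Rightarrow> 'a)) set \<Rightarrow> ('a, 'b) monoid_scheme \<Rightarrow> bool" where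
  "regular_subgroup G N \<longleftrightarrow>
     subgroup G (Hol N) \<and>
     (\<forall>\<eta>\<in>carrier N. \<forall>\<mu>\<in>carrier N. \<exists>!g. g \<in> G \<and> hol_act N g \<eta> = \<mu>)"

definition reg_elem :: "('a \<times> ('a \<Rightarrow> 'a)) set \<Rightarrow> 'a \<Rightarrow> 'a \<times> ('a \<Rightarrow> 'a)" where
  "reg_elem G \<eta> = (THE g. g \<in> G \<and> fst g = \<eta>)"

text \<open>
  Since \<open>fst (reg_elem G \<nu>) = \<nu>\<close>, the product \<open>\<eta> \<circ> \<eta>'\<close> determined by
  \<open>reg_elem G (\<eta> \<circ> \<eta>') = reg_elem G \<eta> \<otimes> reg_elem G \<eta>'\<close> is the first component of the right-hand side.
  The element of \<open>G\<close> with first component \<open>\<one>\<close> is the identity, so \<open>\<one>\<close> is also the neutral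
  element of \<open>\<circ>\<close>.
\<close>

definition brace_of_regular ::
    "('a, 'b) monoid_scheme \<Rightarrow> ('a \<times> ('a \<Rightarrow> 'a)) set \<Rightarrow> 'a brace" where
  "brace_of_regular N G =
     \<lparr>carrier = carrier N, monoid.mult = monoid.mult N, one = \<one>\<^bsub>N\<^esub>,
      circ = (\<lambda>\<eta> \<eta>'. fst (reg_elem G \<eta> \<otimes>\<^bsub>Hol N\<^esub> reg_elem G \<eta>')),
      circ_one = \<one>\<^bsub>N\<^esub>\<rparr>"


section \<open>The group \<open>N\<close> and the subgroup \<open>G\<close>\<close>

definition GL :: "nat \<Rightarrow> 'a::field mat monoid" where
  "GL n = units_of (ring_mat TYPE('a) n ())"

definition aff :: "'a::field mat \<Rightarrow> 'a vec \<Rightarrow> 'a mat" where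
  "aff A w = four_block_mat A (mat_of_cols (dim_vec w) [w]) (0\<^sub>m 1 (dim_col A)) (1\<^sub>m 1)"

definition N_grp :: "nat \<Rightarrow> nat \<Rightarrow> 'a::field mat \<Rightarrow> 'a mat monoid" where
  "N_grp p q M = (GL (p + 1))\<lparr>carrier := {aff (M ^\<^sub>m k) v | k v. k \<le> q - 1 \<and> v \<in> carrier_vec p}\<rparr>"

definition conj_N :: "nat \<Rightarrow> nat \<Rightarrow> 'a::field mat \<Rightarrow> 'a mat \<Rightarrow> 'a mat \<Rightarrow> 'a mat" where
  "conj_N p q M S = (\<lambda>R\<in>carrier (N_grp p q M). S \<otimes>\<^bsub>GL (p + 1)\<^esub> R \<otimes>\<^bsub>GL (p + 1)\<^esub> inv\<^bsub>GL (p + 1)\<^esub> S)"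

text \<open>The standard basis of \<open>V\<close> is numbered from 1, the library's unit vectors from 0.\<close>

definition e_vec :: "nat \<Rightarrow> nat \<Rightarrow> 'a::field vec" where
  "e_vec p i = unit_vec p (i - 1)"

definition X_elem :: "nat \<Rightarrow> nat \<Rightarrow> 'a::field mat \<Rightarrow> 'a mat \<times> ('a mat \<Rightarrow> 'a mat)" where
  "X_elem p q M = (aff M (0\<^sub>v p), conj_N p q M (aff (1\<^sub>m p) (0\<^sub>v p)))"

definition Y_elem :: "nat \<Rightarrow> nat \<Rightarrow> 'a::field mat \<Rightarrow> 'a vec \<Rightarrow> 'a mat \<times> ('a mat \<Rightarrow> 'a mat)" where
  "Y_elem p q M v = (aff (1\<^sub>m p) v, conj_N p q M (aff (1\<^sub>m p) (- v)))"

text \<open>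
  \<^term>\<open>jordan_block p 1\<close> has its off-diagonal ones above the diagonal, so it fixes \<open>e\<^sub>1\<close> and
  maps \<open>e\<^sub>i\<close> to \<open>e\<^sub>i + e\<^sub>i\<^sub>-\<^sub>1\<close> for \<open>i \<ge> 2\<close>: it is the matrix \<open>J\<close>.
\<close>

definition Z_elem :: "nat \<Rightarrow> nat \<Rightarrow> 'a::field mat \<Rightarrow> 'a mat \<times> ('a mat \<Rightarrow> 'a mat)" where
  "Z_elem p q M =
     (aff (1\<^sub>m p) (e_vec p p), conj_N p q M (aff (jordan_block p 1) (- e_vec p p)))"

definition G_sub :: "nat \<Rightarrow> nat \<Rightarrow> 'a::field mat \<Rightarrow> ('a mat \<times> ('a mat \<Rightarrow> 'a mat)) set" where
  "G_sub p q M =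
     generate (Hol (N_grp p q M)) {X_elem p q M, Y_elem p q M (e_vec p (p - 1)), Z_elem p q M}"

end

(*
  Writing the element [R, conj S] of Hol(N) as the pair (RS, S) turns multiplication into
  componentwise multiplication of affine maps. In these terms G consists of the pairs
  (M^k J^i, (J^i, -w)) with w_p = i, hence has exactly one element for each first component
  R = (M^k, M^k w), which is regularity.

  For simplicity, p has order p modulo q. Counting free orbits of M modulo q therefore shows that
  M fixes no nonzero vector and that V has no proper nonzero M-invariant subgroup, so the only
  normal subgroups of N are 1, V and N. Finally V is not normal in the circle group, because
  conjugating Z by X moves its linear part J to M^(1-p) J, and q does not divide p - 1.
*)

theory Submission
  imports Defs "HOL-Number_Theory.Pocklington" "Berlekamp_Zassenhaus.Berlekamp_Type_Based"
begin

section \<open>Regular subgroups of the holomorph\<close>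

text \<open>The coordinates (RS, S) work because [R, conj S][R', conj S'] =
  [R S R' S^-1, conj(SS')], and R S R' S^-1 times SS' is RS R'S'. The last row of J is that of the
  identity, so J preserves the last coordinate. Hence w_p = i survives the product w + J^i w', and
  it ties the power of J to the translation part. The first component of Z is a plain translation by
  e_p, yet Z carries J; this is why translations, normal in N, fail to be normal for the circle
  operation. The order of p modulo q is exactly p: it divides the prime p, and if it were 1 then 1 +
  p + ... + p^(p-1) would be congruent to p modulo q, forcing q to divide both p and p^p - 1. An
  additive subgroup of V has p^d elements, so the orbit counts concern p^d - 1 (nonzero vectors) and
  p^d (p^(p-d) - 1) (complement); q divides the first only if p divides d, the second only if p
  divides p - d. Irreducibility of V reaches the normal subgroups of N through the commutator of a
  translation by u with an element of linear part M^k, which is the translation by u - M^k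
  u.\<close>

lemma Hol_simps:
  "carrier (Hol N) = carrier N \<times> auto N"
  "(\<eta>, \<alpha>) \<otimes>\<^bsub>Hol N\<^esub> (\<mu>, \<beta>) = (\<eta> \<otimes>\<^bsub>N\<^esub> \<alpha> \<mu>, \<alpha> \<otimes>\<^bsub>AutoGroup N\<^esub> \<beta>)"
  "\<one>\<^bsub>Hol N\<^esub> = (\<one>\<^bsub>N\<^esub>, \<one>\<^bsub>AutoGroup N\<^esub>)"
  by (auto simp: Hol_def AutoGroup_def)

lemma auto_memD:
  assumes "\<alpha> \<in> auto N"
  shows "\<alpha> \<in> hom N N" "bij_betw \<alpha> (carrier N) (carrier N)" "\<alpha> \<in> extensional (carrier N)"
    "\<alpha> \<in> Bij (carrier N)"
  using assms by (auto simp: auto_def Bij_def)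

lemma auto_closed: "\<alpha> \<in> auto N \<Longrightarrow> x \<in> carrier N \<Longrightarrow> \<alpha> x \<in> carrier N"
  using auto_memD(1) by (rule hom_in_carrier)

lemma auto_mult:
  "\<alpha> \<in> auto N \<Longrightarrow> x \<in> carrier N \<Longrightarrow> y \<in> carrier N \<Longrightarrow> \<alpha> (x \<otimes>\<^bsub>N\<^esub> y) = \<alpha> x \<otimes>\<^bsub>N\<^esub> \<alpha> y"
  using auto_memD(1) by (rule hom_mult)

lemma (in group) auto_one: "\<alpha> \<in> auto G \<Longrightarrow> \<alpha> \<one> = \<one>"
  by (rule hom_one[OF auto_memD(1)]) (auto intro: is_group)

lemma AutoGroup_mult:
  assumes "\<alpha> \<in> auto N" "\<beta> \<in> auto N"
  shows "\<alpha> \<otimes>\<^bsub>AutoGroup N\<^esub> \<beta> = compose (carrier N) \<alpha> \<beta>"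
  using assms by (simp add: AutoGroup_def BijGroup_def auto_memD)

lemma (in group) Hol_group: "group (Hol G)"
proof -
  interpret A: group "AutoGroup G" by (rule AutoGroup)
  have cA: "carrier (AutoGroup G) = auto G" by (simp add: AutoGroup_def)
  have mA: "(\<alpha> \<otimes>\<^bsub>AutoGroup G\<^esub> \<beta>) x = \<alpha> (\<beta> x)"
    if "\<alpha> \<in> auto G" "\<beta> \<in> auto G" "x \<in> carrier G" for \<alpha> \<beta> x
    using that by (simp add: AutoGroup_mult compose_eq)
  have oneA: "\<one>\<^bsub>AutoGroup G\<^esub> x = x" if "x \<in> carrier G" for x
    using that by (simp add: AutoGroup_def BijGroup_def)
  show ?thesis
  proof (rule groupI)
    fix x y assume "x \<in> carrier (Hol G)" "y \<in> carrier (Hol G)"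
    then show "x \<otimes>\<^bsub>Hol G\<^esub> y \<in> carrier (Hol G)"
      using A.m_closed by (auto simp: Hol_simps auto_closed cA)
  next
    show "\<one>\<^bsub>Hol G\<^esub> \<in> carrier (Hol G)"
      using A.one_closed by (auto simp: Hol_simps cA)
  next
    fix x y z assume "x \<in> carrier (Hol G)" "y \<in> carrier (Hol G)" "z \<in> carrier (Hol G)"
    then show "x \<otimes>\<^bsub>Hol G\<^esub> y \<otimes>\<^bsub>Hol G\<^esub> z = x \<otimes>\<^bsub>Hol G\<^esub> (y \<otimes>\<^bsub>Hol G\<^esub> z)"
      using A.m_assoc by (auto simp: Hol_simps auto_closed cA auto_mult mA m_assoc)
  next
    fix x assume "x \<in> carrier (Hol G)"
    then show "\<one>\<^bsub>Hol G\<^esub> \<otimes>\<^bsub>Hol G\<^esub> x = x"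
      using A.l_one by (auto simp: Hol_simps cA oneA)
  next
    fix x assume "x \<in> carrier (Hol G)"
    then obtain \<eta> \<alpha> where x: "x = (\<eta>, \<alpha>)" "\<eta> \<in> carrier G" "\<alpha> \<in> auto G"
      by (auto simp: Hol_simps)
    let ?\<beta> = "inv\<^bsub>AutoGroup G\<^esub> \<alpha>"
    have \<beta>: "?\<beta> \<in> auto G" using A.inv_closed x cA by auto
    have "(?\<beta> (inv \<eta>), ?\<beta>) \<otimes>\<^bsub>Hol G\<^esub> x = \<one>\<^bsub>Hol G\<^esub>"
      using x \<beta> A.l_inv cA
      by (simp add: Hol_simps auto_mult[symmetric] auto_one)
    moreover have "(?\<beta> (inv \<eta>), ?\<beta>) \<in> carrier (Hol G)"
      using x \<beta> by (auto simp: Hol_simps auto_closed)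
    ultimately show "\<exists>y\<in>carrier (Hol G). y \<otimes>\<^bsub>Hol G\<^esub> x = \<one>\<^bsub>Hol G\<^esub>" by blast
  qed
qed

lemma (in group) hol_act_mult:
  assumes "g \<in> carrier (Hol G)" "h \<in> carrier (Hol G)" "x \<in> carrier G"
  shows "hol_act G (g \<otimes>\<^bsub>Hol G\<^esub> h) x = hol_act G g (hol_act G h x)"
  using assms
  by (auto simp: hol_act_def Hol_simps AutoGroup_mult compose_eq auto_mult auto_closed m_assoc)

lemma (in group) hol_act_one:
  "g \<in> carrier (Hol G) \<Longrightarrow> hol_act G g \<one> = fst g"
  by (auto simp: hol_act_def Hol_simps auto_one)

text \<open>An element of the holomorph sends 1 to its first component, so the right side is
  regularity at the base point 1. This suffices: if h sends 1 to \<eta> and k sends 1 to \<mu>, then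
  g sends \<eta> to \<mu> exactly when gh = k.\<close>

lemma (in group) regular_subgroup_iff:
  "regular_subgroup H G \<longleftrightarrow>
     subgroup H (Hol G) \<and> (\<forall>\<eta>\<in>carrier G. \<exists>!g. g \<in> H \<and> fst g = \<eta>)"
proof (cases "subgroup H (Hol G)")
  case True
  interpret Hol: group "Hol G" by (rule Hol_group)
  interpret H: subgroup H "Hol G" by fact
  have "(\<forall>\<eta>\<in>carrier G. \<forall>\<mu>\<in>carrier G. \<exists>!g. g \<in> H \<and> hol_act G g \<eta> = \<mu>) \<longleftrightarrow>
    (\<forall>\<eta>\<in>carrier G. \<exists>!g. g \<in> H \<and> fst g = \<eta>)" (is "?L \<longleftrightarrow> ?R")
  proof
    assume ?L
    then have "\<exists>!g. g \<in> H \<and> hol_act G g \<one> = \<mu>" if "\<mu> \<in> carrier G" for \<mu>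
      using that by blast
    then show ?R by (metis hol_act_one H.mem_carrier)
  next
    assume R: ?R
    show ?L
    proof (intro ballI)
      fix \<eta> \<mu> assume \<eta>: "\<eta> \<in> carrier G" and \<mu>: "\<mu> \<in> carrier G"
      obtain h where h: "h \<in> H" "fst h = \<eta>" using R \<eta> by blast
      obtain k where k: "k \<in> H" "fst k = \<mu>" using R \<mu> by blast
      have act: "hol_act G g \<eta> = fst (g \<otimes>\<^bsub>Hol G\<^esub> h)" if "g \<in> H" for g
        using that h hol_act_mult[of g h \<one>]
        by (simp add: hol_act_one)
      have "hol_act G (k \<otimes>\<^bsub>Hol G\<^esub> inv\<^bsub>Hol G\<^esub> h) \<eta> = \<mu>"
        using h k by (subst act) (auto simp: Hol.m_assoc)
      moreover have "g = k \<otimes>\<^bsub>Hol G\<^esub> inv\<^bsub>Hol G\<^esub> h" if "g \<in> H" "hol_act G g \<eta> = \<mu>" for g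
      proof -
        have "g \<otimes>\<^bsub>Hol G\<^esub> h = k"
          using that act h k R \<mu> H.m_closed by metis
        then show ?thesis using that h by (subst Hol.inv_solve_right) auto
      qed
      ultimately show "\<exists>!g. g \<in> H \<and> hol_act G g \<eta> = \<mu>"
        using h k by (metis H.m_closed H.m_inv_closed)
    qed
  qed
  then show ?thesis by (simp add: regular_subgroup_def)
qed (simp add: regular_subgroup_def)

lemma brace_of_regular_simps:
  "carrier (brace_of_regular N H) = carrier N"
  "monoid.mult (brace_of_regular N H) = monoid.mult N"
  "one (brace_of_regular N H) = one N"
  "circ (brace_of_regular N H) = (\<lambda>\<eta> \<eta>'. fst (reg_elem H \<eta> \<otimes>\<^bsub>Hol N\<^esub> reg_elem H \<eta>'))"
  "circ_one (brace_of_regular N H) = one N"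
  by (simp_all add: brace_of_regular_def)

lemma circ_group_simps:
  "carrier (circ_group B) = carrier B"
  "monoid.mult (circ_group B) = circ B"
  "one (circ_group B) = circ_one B"
  by (simp_all add: circ_group_def)

text \<open>A brace record carries extra fields and is thus a different structure from its additive
  group; facts are carried across by agreement of the three group components.\<close>

lemma (in group) same_operations_group:
  assumes "carrier B = carrier G" "monoid.mult B = monoid.mult G" "one B = \<one>"
  shows "group B" "x \<in> carrier G \<Longrightarrow> inv\<^bsub>B\<^esub> x = inv x" "id \<in> iso B G"
proof -
  show B: "group B"
    by (rule groupI) (use assms m_assoc l_inv_ex in auto)
  show "inv\<^bsub>B\<^esub> x = inv x" if "x \<in> carrier G"
    by (rule group.inv_equality[OF B]) (use that assms in auto)
  show "id \<in> iso B G"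
    by (rule isoI) (auto simp: hom_def assms)
qed

section \<open>From a regular subgroup of the holomorph to its skew brace\<close>

locale regular_holomorph = group N for N :: "('a, 'b) monoid_scheme" (structure) +
  fixes H
  assumes regular: "regular_subgroup H N"
begin

sublocale Hol: group "Hol N" by (rule Hol_group)

sublocale H: subgroup H "Hol N"
  using regular by (simp add: regular_subgroup_def)

lemma reg_elem_unique: "\<exists>!g. g \<in> H \<and> fst g = \<eta>" if "\<eta> \<in> carrier N"
  using regular that by (simp add: regular_subgroup_iff)

lemma reg_elem:
  assumes "\<eta> \<in> carrier N"
  shows "reg_elem H \<eta> \<in> H" "fst (reg_elem H \<eta>) = \<eta>"
  using theI'[OF reg_elem_unique[OF assms]] by (auto simp: reg_elem_def)

lemma fst_closed: "g \<in> H \<Longrightarrow> fst g \<in> carrier N"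
  using H.subset by (auto simp: Hol_simps)

lemma reg_elem_fst: "g \<in> H \<Longrightarrow> reg_elem H (fst g) = g"
  using reg_elem_unique reg_elem fst_closed by metis

abbreviation "B \<equiv> brace_of_regular N H"

lemma reg_elem_circ:
  assumes "x \<in> carrier N" "y \<in> carrier N"
  shows "reg_elem H (circ B x y) = reg_elem H x \<otimes>\<^bsub>Hol N\<^esub> reg_elem H y"
  using assms by (simp add: brace_of_regular_simps reg_elem reg_elem_fst)

lemma circ_closed:
  assumes "x \<in> carrier N" "y \<in> carrier N"
  shows "circ B x y \<in> carrier N"
  using assms by (simp add: brace_of_regular_simps reg_elem fst_closed)

lemma reg_elem_one: "reg_elem H \<one> = \<one>\<^bsub>Hol N\<^esub>"
  using reg_elem_fst[OF H.one_closed] by (simp add: Hol_simps)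

lemma bij_betw_reg_elem: "bij_betw (reg_elem H) (carrier N) H"
  by (rule bij_betw_byWitness[where f' = fst])
    (use H.subset in \<open>auto simp: reg_elem reg_elem_fst Hol_simps subset_iff\<close>)

lemma reg_elem_inj: "x \<in> carrier N \<Longrightarrow> y \<in> carrier N \<Longrightarrow> reg_elem H x = reg_elem H y \<Longrightarrow> x = y"
  by (metis reg_elem(2))

text \<open>\<open>reg_elem H\<close> is injective and turns the circle operation into
  multiplication in \<open>Hol N\<close>, so each axiom is pulled back along it.\<close>

lemma circ_group: "group (circ_group B)"
proof (rule groupI)
  fix x y z
  assume "x \<in> carrier (circ_group B)" "y \<in> carrier (circ_group B)" "z \<in> carrier (circ_group B)"
  then show "x \<otimes>\<^bsub>circ_group B\<^esub> y \<otimes>\<^bsub>circ_group B\<^esub> z =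
      x \<otimes>\<^bsub>circ_group B\<^esub> (y \<otimes>\<^bsub>circ_group B\<^esub> z)"
    by (intro reg_elem_inj) (simp_all add: circ_group_simps reg_elem_circ circ_closed reg_elem Hol.m_assoc
        brace_of_regular_simps(1,5))
next
  fix x assume "x \<in> carrier (circ_group B)"
  then have x: "x \<in> carrier N" by (simp add: circ_group_simps brace_of_regular_simps)
  show "\<one>\<^bsub>circ_group B\<^esub> \<otimes>\<^bsub>circ_group B\<^esub> x = x"
    by (rule reg_elem_inj)
     (use x in \<open>simp_all add: circ_group_simps brace_of_regular_simps(1,5) circ_closed
         reg_elem_circ reg_elem_one reg_elem\<close>)
  define y where "y = fst (inv\<^bsub>Hol N\<^esub> reg_elem H x)"
  have y: "reg_elem H y = inv\<^bsub>Hol N\<^esub> reg_elem H x" "y \<in> carrier N"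
    using x by (simp_all add: y_def reg_elem reg_elem_fst fst_closed)
  have "circ B y x = \<one>"
    by (rule reg_elem_inj)
       (use x y in \<open>simp_all add: circ_closed reg_elem_circ reg_elem_one reg_elem\<close>)
  then show "\<exists>y\<in>carrier (circ_group B). y \<otimes>\<^bsub>circ_group B\<^esub> x = \<one>\<^bsub>circ_group B\<^esub>"
    using y by (auto simp: circ_group_simps brace_of_regular_simps(1,5))
qed (auto simp: circ_group_simps circ_closed brace_of_regular_simps(1,5))

lemma circ_group_iso: "circ_group B \<cong> (Hol N)\<lparr>carrier := H\<rparr>"
  by (rule is_isoI[of "reg_elem H"], rule isoI)
    (use bij_betw_reg_elem in
      \<open>auto simp: hom_def circ_group_simps brace_of_regular_simps(1) reg_elem reg_elem_circ\<close>)

text \<open>With \<alpha> the automorphism part of the element of H over a, a circ x is a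
  \<alpha>(x). The brace law is then multiplicativity of \<alpha>, with inv a cancelling the second
  a.\<close>

lemma brace_skew_brace: "skew_brace B"
proof -
  note B = same_operations_group[of B, OF brace_of_regular_simps(1-3)]
  have law: "circ B a (b \<otimes> c) = circ B a b \<otimes> inv a \<otimes> circ B a c"
    if "a \<in> carrier N" "b \<in> carrier N" "c \<in> carrier N" for a b c
  proof -
    obtain \<alpha> where \<alpha>: "reg_elem H a = (a, \<alpha>)" "\<alpha> \<in> auto N"
      using reg_elem[OF \<open>a \<in> carrier N\<close>] H.subset by (cases "reg_elem H a") (auto simp: Hol_simps)
    have "circ B a x = a \<otimes> \<alpha> x" if "x \<in> carrier N" for x
      using reg_elem[OF that]
      by (cases "reg_elem H x") (auto simp: brace_of_regular_simps \<alpha> Hol_simps)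
    then show ?thesis
      using that \<alpha> by (simp add: auto_mult auto_closed m_assoc) (simp add: auto_closed flip: m_assoc)
  qed
  show ?thesis
    unfolding skew_brace_def skew_brace_axioms_def
    using B(1) circ_group law
    by (auto simp: brace_of_regular_simps(1-3) B(2))
qed

end

section \<open>Normal subgroups and free orbits\<close>

text \<open>Normality in the form xh = h'x lets conjugates in the circle group be examined without a
  formula for circle inverses.\<close>

lemma normal_commute:
  assumes "I \<lhd> G" "x \<in> carrier G" "h \<in> I"
  obtains h' where "h' \<in> I" "x \<otimes>\<^bsub>G\<^esub> h = h' \<otimes>\<^bsub>G\<^esub> x"
proof -
  have "x \<otimes>\<^bsub>G\<^esub> h \<in> x <#\<^bsub>G\<^esub> I" using assms(3) by (auto simp: l_coset_def)
  also have "x <#\<^bsub>G\<^esub> I = I #>\<^bsub>G\<^esub> x" using normal.coset_eq[OF assms(1)] assms(2) by blast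
  finally show ?thesis using that by (auto simp: r_coset_def)
qed

lemma normal_conj_mem:
  assumes "I \<lhd> G" "x \<in> carrier G" "h \<in> I" "h' \<in> carrier G"
    and "x \<otimes>\<^bsub>G\<^esub> h = h' \<otimes>\<^bsub>G\<^esub> x"
  shows "h' \<in> I"
proof -
  interpret normal I G by (rule assms(1))
  obtain k where k: "k \<in> I" "x \<otimes>\<^bsub>G\<^esub> h = k \<otimes>\<^bsub>G\<^esub> x"
    using normal_commute[OF assms(1-3)] .
  then show ?thesis using assms(2,4,5) mem_carrier by (metis r_cancel)
qed

text \<open>The iterates of f form an action of the cyclic group of prime order q. A point fixed by
  f^d with 0 < d < q would be fixed by f, so every orbit has exactly q elements, and the orbits
  partition S.\<close>

lemma prime_dvd_card_fixpoint_free: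
  fixes f :: "'a \<Rightarrow> 'a"
  assumes fin: "finite S" and maps: "f ` S \<subseteq> S" and q: "Factorial_Ring.prime q"
    and pow: "\<And>x. x \<in> S \<Longrightarrow> (f ^^ q) x = x" and nofix: "\<And>x. x \<in> S \<Longrightarrow> f x \<noteq> x"
  shows "q dvd card S"
proof -
  define orb where "orb x = (\<lambda>i. (f ^^ i) x) ` {..<q}" for x
  have q0: "q > 0" using q by (rule prime_gt_0_nat)
  have inS: "(f ^^ i) x \<in> S" if "x \<in> S" for x i
    using that maps by (induct i) auto
  have mult: "(f ^^ (q * j)) x = x" if "x \<in> S" for x j
    using that by (induct j) (auto simp: funpow_add pow)
  have pmod: "(f ^^ (i mod q)) x = (f ^^ i) x" if "x \<in> S" for x i
    using mult[OF that] funpow_add[of "i mod q" "q * (i div q)" f] by (simp add: comp_def)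
  have orb_all: "(f ^^ i) x \<in> orb x" if "x \<in> S" for x i
    unfolding orb_def using pmod[OF that, of i] q0
    by (metis imageI lessThan_iff mod_less_divisor)
  have free: "i = j" if x: "x \<in> S" and "i < q" "j < q" "(f ^^ i) x = (f ^^ j) x" for x i j
  proof -
    have False if ij: "i < j" "j < q" "(f ^^ i) x = (f ^^ j) x" for i j
    proof -
      define d where "d = j - i"
      \<comment> \<open>Applying f^(q-i) to both sides turns the left one into f^q x = x and the
        right one into f^d x.\<close>
      have "(f ^^ (q - i + i)) x = (f ^^ (q - i + j)) x"
        using ij(3) by (simp only: funpow_add comp_apply)
      moreover have "q - i + j = d + q" using ij by (simp add: d_def)
      ultimately have d: "(f ^^ d) x = x" using ij by (simp add: pow x funpow_add)
      have dm: "(f ^^ (d * m)) x = x" for m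
        using d by (induct m) (auto simp: funpow_add)
      \<comment> \<open>the short name \<open>coprime\<close> is taken by \<open>comm_monoid_mult_class.coprime\<close>\<close>
      have "algebraic_semidom_class.coprime d q"
        using prime_imp_coprime[OF q, of d] nat_dvd_not_less[of d q] ij
        by (simp add: d_def algebraic_semidom_class.coprime_commute[of _ q])
      \<comment> \<open>With m inverse to d modulo q, f^(dm) acts on x as f does, and it fixes x
        because f^d does.\<close>
      then obtain m where "[d * m = 1] (mod q)" using cong_solve_coprime_nat[of d q] by auto
      then have "(d * m) mod q = 1 mod q" by (simp add: cong_def)
      then have "f x = x"
        using pmod[OF x, of "d * m"] pmod[OF x, of 1] dm[of m] by simp
      then show False using nofix x by blast
    qed
    then show ?thesis using that by (metis linorder_neqE_nat)
  qed
  have card_orb: "card (orb x) = q" if "x \<in> S" for x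
    unfolding orb_def using free[OF that] by (subst card_image) (auto simp: inj_on_def)
  have orb_eq: "orb x = orb y" if "x \<in> S" "y \<in> S" "z \<in> orb x" "z \<in> orb y" for x y z
  proof -
    have sub: "orb z \<subseteq> orb x \<and> orb x \<subseteq> orb z" if "x \<in> S" "z \<in> orb x" for x
    proof -
      obtain i where i: "i < q" "z = (f ^^ i) x" using \<open>z \<in> orb x\<close> by (auto simp: orb_def)
      have "(f ^^ j) z \<in> orb x" for j
        using orb_all[OF \<open>x \<in> S\<close>, of "j + i"] by (simp add: i(2) funpow_add)
      then have "orb z \<subseteq> orb x" by (auto simp: orb_def[of z])
      \<comment> \<open>Going q - i steps further closes the cycle, so x also lies in the orbit of
        z.\<close>
      moreover have "(f ^^ (q - i)) z = x"
        using i pow[OF \<open>x \<in> S\<close>] by (simp flip: comp_apply[of "f ^^ _" "f ^^ _"] funpow_add)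
      then have "(f ^^ j) x \<in> orb z" for j
        using orb_all[of z "j + (q - i)"] inS[OF \<open>x \<in> S\<close>, of i]
        unfolding funpow_add comp_apply by (simp add: i(2))
      then have "orb x \<subseteq> orb z" by (auto simp: orb_def[of x])
      ultimately show ?thesis by blast
    qed
    show ?thesis using sub that by blast
  qed
  have Union_orb: "\<Union>(orb ` S) = S"
  proof
    show "\<Union>(orb ` S) \<subseteq> S" using inS by (auto simp: orb_def)
    have "x \<in> orb x" if "x \<in> S" for x using orb_all[OF that, of 0] by simp
    then show "S \<subseteq> \<Union>(orb ` S)" by auto
  qed
  have "q dvd card (\<Union>(orb ` S))"
  proof (rule dvd_partition)
    show "finite (\<Union>(orb ` S))" using fin Union_orb by simp
    show "\<forall>c\<in>orb ` S. q dvd card c" using card_orb by simp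
    show "\<forall>c1\<in>orb ` S. \<forall>c2\<in>orb ` S. c1 \<noteq> c2 \<longrightarrow> c1 \<inter> c2 = {}"
      using orb_eq by blast
  qed
  then show ?thesis unfolding Union_orb .
qed

text \<open>Everything rests on p^p - 1 = (p - 1)(1 + p + ... + p^(p-1)). The last conclusion says
  that p has multiplicative order p modulo q, which the first and third yield since p is
  prime.\<close>

lemma prime_dvd_repunit:
  fixes p q :: nat
  assumes p: "Factorial_Ring.prime p" and q: "Factorial_Ring.prime q"
    and dvd: "q dvd (p ^ p - 1) div (p - 1)"
  shows "q dvd p ^ p - 1" "\<not> q dvd p" "\<not> q dvd p - 1" "q dvd p ^ e - 1 \<Longrightarrow> p dvd e"
proof -
  have p2: "p \<ge> 2" using p by (rule prime_ge_2_nat)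
  have eq: "p ^ p - 1 = (p - 1) * (\<Sum>i<p. p ^ i)"
  proof -
    have "int (p ^ p - 1) = int ((p - 1) * (\<Sum>i<p. p ^ i))"
      using p2 power_diff_1_eq[of "int p" p] by (simp add: of_nat_diff)
    then show ?thesis by (simp only: of_nat_eq_iff)
  qed
  then have sum: "q dvd (\<Sum>i<p. p ^ i)" using dvd p2 by simp
  then show pp: "q dvd p ^ p - 1" using eq by simp
  show qp: "\<not> q dvd p"
  proof
    assume "q dvd p"
    then have "q dvd p ^ p" using p2 by (intro dvd_trans[OF _ dvd_power]) auto
    then have "q dvd p ^ p - (p ^ p - 1)" using pp by (rule dvd_diff_nat)
    moreover have "p ^ p \<ge> 1" using p2 by simp
    ultimately have "q dvd 1" by simp
    then show False using q by simp
  qed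
  have cong1: "[p ^ e = 1] (mod q) \<longleftrightarrow> q dvd p ^ e - 1" for e
    using p2 by (subst cong_altdef_nat[of 1 "p ^ e"]) auto
  show n1: "\<not> q dvd p - 1"
  proof
    assume "q dvd p - 1"
    then have "[p = 1] (mod q)" using cong1[of 1] by simp
    \<comment> \<open>The sum of p ones is p, so q would divide p, already excluded.\<close>
    then have "[(\<Sum>i<p. p ^ i) = (\<Sum>i<p. 1 ^ i)] (mod q)"
      by (intro cong_sum cong_pow)
    then have "q dvd p" using sum by (simp add: cong_dvd_iff)
    then show False using qp by blast
  qed
  have "Pocklington.ord q p dvd p"
    using pp cong1 by (metis ord_divides)
  moreover have "\<not> Pocklington.ord q p dvd 1"
    using n1 cong1[of 1] by (metis ord_divides power_one_right)
  ultimately have "Pocklington.ord q p = p"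
    using p by (auto simp: prime_nat_iff)
  then show "p dvd e" if "q dvd p ^ e - 1" using that cong1 by (metis ord_divides)
qed

section \<open>Affine matrices\<close>

lemma GL_simps:
  "carrier (GL n) = Units (ring_mat TYPE('a::field) n ())"
  "(A::'a mat) \<otimes>\<^bsub>GL n\<^esub> B = A * B"
  "\<one>\<^bsub>GL n\<^esub> = (1\<^sub>m n :: 'a mat)"
  by (simp_all add: GL_def units_of_def ring_mat_simps)

lemma GL_group: "group (GL n :: 'a::field mat monoid)"
proof -
  interpret ring "ring_mat TYPE('a) n ()" by (rule ring_mat)
  show ?thesis unfolding GL_def by (rule units_group)
qed

lemma GL_iff:
  "A \<in> carrier (GL n) \<longleftrightarrow>
    A \<in> carrier_mat n n \<and> (\<exists>B\<in>carrier_mat n n. B * A = 1\<^sub>m n \<and> A * B = 1\<^sub>m n)"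
  by (auto simp: GL_simps Units_def ring_mat_simps)

lemma GL_nat_pow: "A \<in> carrier (GL n) \<Longrightarrow> A [^]\<^bsub>GL n\<^esub> (k::nat) = A ^\<^sub>m k"
proof (induct k)
  case 0
  then show ?case by (auto simp: GL_simps(3) GL_iff)
next
  case (Suc k)
  then show ?case by (simp add: GL_simps(2))
qed

lemma aff_carrier: "A \<in> carrier_mat n n \<Longrightarrow> w \<in> carrier_vec n \<Longrightarrow> aff A w \<in> carrier_mat (n + 1) (n + 1)"
  by (auto simp: aff_def intro!: four_block_carrier_mat)

lemma aff_mult:
  assumes "A \<in> carrier_mat n n" "A' \<in> carrier_mat n n" "w \<in> carrier_vec n" "w' \<in> carrier_vec n"
  shows "aff A w * aff A' w' = aff (A * A') (A *\<^sub>v w' + w)"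
proof -
  have dims: "dim_vec w = n" "dim_vec w' = n" "dim_col A = n" "dim_col A' = n"
    "dim_vec (A *\<^sub>v w' + w) = n" "dim_col (A * A') = n"
    using assms by auto
  have "A * mat_of_cols n [w'] + mat_of_cols n [w] = mat_of_cols n [A *\<^sub>v w' + w]"
    using assms by (intro eq_matI) (auto simp: mat_of_cols_def scalar_prod_def row_def)
  then show ?thesis
    unfolding aff_def dims using assms
    by (subst mult_four_block_mat[of _ n n _ 1 _ 1 _ _ n _ 1]) auto
qed

lemma aff_one: "aff (1\<^sub>m n) (0\<^sub>v n) = 1\<^sub>m (n + 1)"
  by (rule eq_matI) (auto simp: aff_def mat_of_cols_def less_Suc_eq)

lemma aff_inject:
  assumes "A \<in> carrier_mat n n" "A' \<in> carrier_mat n n" "w \<in> carrier_vec n" "w' \<in> carrier_vec n"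
  shows "aff A w = aff A' w' \<longleftrightarrow> A = A' \<and> w = w'"
proof
  assume eq: "aff A w = aff A' w'"
  have "A $$ (i, j) = A' $$ (i, j)" if "i < n" "j < n" for i j
    using arg_cong[OF eq, of "\<lambda>X. X $$ (i, j)"] assms that by (simp add: aff_def)
  moreover have "w $ i = w' $ i" if "i < n" for i
    using arg_cong[OF eq, of "\<lambda>X. X $$ (i, n)"] assms that by (simp add: aff_def mat_of_cols_def)
  ultimately show "A = A' \<and> w = w'" using assms by (auto intro!: eq_matI eq_vecI)
qed simp

lemma aff_GL:
  assumes "A \<in> carrier (GL n)" "w \<in> carrier_vec n"
  shows "aff A w \<in> carrier (GL (n + 1))"
proof -
  obtain B where B: "A \<in> carrier_mat n n" "B \<in> carrier_mat n n" "B * A = 1\<^sub>m n" "A * B = 1\<^sub>m n"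
    using assms(1) by (auto simp: GL_iff)
  \<comment> \<open>The inverse of x -> Ax + w is x -> Bx - Bw.\<close>
  let ?u = "- (B *\<^sub>v w)"
  have u: "?u \<in> carrier_vec n" using B assms by auto
  have "A *\<^sub>v ?u = - (A *\<^sub>v (B *\<^sub>v w))"
    using B assms by (intro eq_vecI) auto
  also have "\<dots> = - (A * B *\<^sub>v w)"
    using B assms by (subst assoc_mult_mat_vec[of A n n B n]) auto
  finally have 1: "A *\<^sub>v ?u + w = 0\<^sub>v n"
    using B assms by auto
  have 2: "B *\<^sub>v w + ?u = 0\<^sub>v n"
    using B assms by (intro eq_vecI) auto
  have "aff A w * aff B ?u = 1\<^sub>m (n + 1)" "aff B ?u * aff A w = 1\<^sub>m (n + 1)"
    using aff_mult[OF B(1,2) assms(2) u] aff_mult[OF B(2,1) u assms(2)] B(3,4)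
    by (simp_all only: 1 2 aff_one)
  then show ?thesis
    unfolding GL_iff using aff_carrier B u assms by blast
qed

section \<open>Matrix powers, Jordan blocks and additive subgroups of vectors\<close>

lemma pow_mat_add:
  assumes "A \<in> carrier_mat n n"
  shows "A ^\<^sub>m (k + l) = A ^\<^sub>m k * A ^\<^sub>m l"
proof (induct l)
  case (Suc l)
  then show ?case using assms by (simp add: assoc_mult_mat[of _ n n _ n _ n])
qed (use assms in auto)

lemma pow_mat_mult:
  assumes "A \<in> carrier_mat n n"
  shows "A ^\<^sub>m (k * l) = (A ^\<^sub>m k) ^\<^sub>m l"
proof (induct l)
  case (Suc l)
  then show ?case using assms pow_mat_add[OF assms, of "k * l" k] by (simp add: add.commute)
qed (use assms in auto)

lemma pow_mat_mult_commute:
  assumes J: "J \<in> carrier_mat n n" and A: "A \<in> carrier_mat n n" and rel: "J * A = A ^\<^sub>m p * J"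
  shows "J ^\<^sub>m i * A ^\<^sub>m k = A ^\<^sub>m (k * p ^ i) * J ^\<^sub>m i"
proof -
  have one: "J * A ^\<^sub>m k = A ^\<^sub>m (k * p) * J" for k
  proof (induct k)
    case (Suc k)
    have "J * A ^\<^sub>m Suc k = J * A ^\<^sub>m k * A" using J A by (simp add: assoc_mult_mat[of _ n n _ n _ n])
    also have "\<dots> = A ^\<^sub>m (k * p) * (J * A)"
      using Suc J A by (simp add: assoc_mult_mat[of _ n n _ n _ n])
    also have "\<dots> = A ^\<^sub>m (k * p) * A ^\<^sub>m p * J"
      using J A by (simp add: rel assoc_mult_mat[of _ n n _ n _ n])
    also have "\<dots> = A ^\<^sub>m (Suc k * p) * J"
      using pow_mat_add[OF A, of "k * p" p] by (simp add: add.commute)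
    finally show ?case .
  qed (use J A in auto)
  show ?thesis
  proof (induct i arbitrary: k)
    case (Suc i)
    have "J ^\<^sub>m Suc i * A ^\<^sub>m k = J ^\<^sub>m i * A ^\<^sub>m (k * p) * J"
      using J A one by (simp add: assoc_mult_mat[of _ n n _ n _ n])
    also have "\<dots> = A ^\<^sub>m (k * p ^ Suc i) * J ^\<^sub>m Suc i"
      using J A by (simp add: Suc assoc_mult_mat[of _ n n _ n _ n] mult.assoc)
    finally show ?case .
  qed (use J A in auto)
qed

text \<open>Above the diagonal, the (i, j) entry of J^p is the binomial coefficient of p over j - i.
  Here 0 < j - i < p, so p divides it.\<close>

lemma jordan_block_pow_card:
  assumes p: "p = CARD('p::prime_card)" 
  shows "(jordan_block p (1 :: 'p mod_ring)) ^\<^sub>m p = 1\<^sub>m p"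
proof (rule eq_matI)
  have prime: "Factorial_Ring.prime p" using p prime_card by simp
  fix i j assume "i < dim_row (1\<^sub>m p :: 'p mod_ring mat)" "j < dim_col (1\<^sub>m p :: 'p mod_ring mat)"
  then have ij: "i < p" "j < p" by auto
  have "of_nat (p choose (j - i)) = (0 :: 'p mod_ring)" if "i < j"
  proof -
    have "p dvd p choose (j - i)" using prime that ij by (intro dvd_choose_prime) auto
    then show ?thesis unfolding p by (metis dvdE mult_zero_left of_nat_card_eq_0 of_nat_mult)
  qed
  then show "(jordan_block p (1 :: 'p mod_ring) ^\<^sub>m p) $$ (i, j) = 1\<^sub>m p $$ (i, j)"
    using ij by (auto simp: jordan_block_pow)
qed auto

lemma jordan_block_mult_vec_index:
  assumes "w \<in> carrier_vec n" "i < n"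
  shows "(jordan_block n (1::'a::comm_ring_1) *\<^sub>v w) $ i =
    w $ i + (if Suc i < n then w $ Suc i else 0)"
proof -
  have "(jordan_block n (1::'a) *\<^sub>v w) $ i =
      (\<Sum>j<n. (if i = j then 1 else if Suc i = j then 1 else 0) * w $ j)"
    using assms by (auto simp: scalar_prod_def lessThan_atLeast0 intro!: sum.cong)
  also have "\<dots> = (\<Sum>j<n. (if i = j then w $ j else 0) + (if Suc i = j then w $ j else 0))"
    by (rule sum.cong) auto
  also have "\<dots> = w $ i + (if Suc i < n then w $ Suc i else 0)"
    using assms(2) by (simp add: sum.distrib)
  finally show ?thesis .
qed

lemma mat_eq_one_if_fixes:
  assumes A: "(A :: 'a::comm_ring_1 mat) \<in> carrier_mat n n"
    and fix_all: "\<And>v. v \<in> carrier_vec n \<Longrightarrow> A *\<^sub>v v = v"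
  shows "A = 1\<^sub>m n"
proof (rule eq_matI)
  fix i j assume "i < dim_row (1\<^sub>m n :: 'a mat)" "j < dim_col (1\<^sub>m n :: 'a mat)"
  then have ij: "i < n" "j < n" by auto
  have "(A *\<^sub>v unit_vec n j) $ i = unit_vec n j $ i"
    using fix_all[of "unit_vec n j"] by simp
  then show "A $$ (i, j) = 1\<^sub>m n $$ (i, j)" using A ij by simp
qed (use A in auto)

text \<open>Lagrange's theorem in an additive group of order p^n.\<close>

lemma vec_subgroup_card:
  fixes S :: "'p::prime_card mod_ring vec set"
  assumes "p = CARD('p)" and "subgroup S (monoid_vec TYPE('p mod_ring) n)"
  obtains d where "d \<le> n" "card S = p ^ d"
proof -
  interpret V: comm_group "monoid_vec TYPE('p mod_ring) n" by (rule comm_group_vec)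
  have "card S * card (rcosets\<^bsub>monoid_vec TYPE('p mod_ring) n\<^esub> S) = p ^ n"
    using V.lagrange[OF assms(2)] assms(1)
    by (simp add: Coset.order_def monoid_vec_simps card_carrier_vec mult.commute)
  then have "card S dvd p ^ n" by (metis dvd_triv_left)
  then show ?thesis
    using that prime_card[where 'a = 'p] assms(1) by (auto simp: divides_primepow_nat)
qed

lemma mult_mat_vec_uminus:
  fixes A :: "'a::comm_ring_1 mat"
  shows "A \<in> carrier_mat n m \<Longrightarrow> w \<in> carrier_vec m \<Longrightarrow> A *\<^sub>v (- w) = - (A *\<^sub>v w)"
  by (intro eq_vecI) auto

lemma mult_mat_vec_zero:
  fixes A :: "'a::comm_ring_1 mat"
  shows "A \<in> carrier_mat n m \<Longrightarrow> A *\<^sub>v 0\<^sub>v m = 0\<^sub>v n"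
  by (intro eq_vecI) auto

section \<open>The skew brace of \<open>G\<close>\<close>

locale jordan_brace =
  fixes p q :: nat and M :: "'p::prime_card mod_ring mat"
  assumes p_card: "p = CARD('p)" and q_prime: "Factorial_Ring.prime q"
    and q_dvd: "q dvd (p ^ p - 1) div (p - 1)"
    and M_GL: "M \<in> carrier (GL p)" and M_ord: "group.ord (GL p) M = q"
    and J_rel: "jordan_block p 1 * M * inv\<^bsub>GL p\<^esub> (jordan_block p 1) = M ^\<^sub>m p"
begin

abbreviation "V \<equiv> carrier_vec p :: 'p mod_ring vec set"
abbreviation "J \<equiv> jordan_block p 1 :: 'p mod_ring mat"
abbreviation "N \<equiv> N_grp p q M"

lemma p_prime: "Factorial_Ring.prime p"
  using p_card prime_card by simp

lemma p_ge_2: "p \<ge> 2"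
  using p_prime by (rule prime_ge_2_nat)

lemma q_pos: "q > 0"
  using q_prime by (rule prime_gt_0_nat)

lemmas repunit_facts = prime_dvd_repunit[OF p_prime q_prime q_dvd]

lemma card_V: "card V = p ^ p"
  by (simp add: card_carrier_vec p_card)

lemma of_nat_eq_iff_cong: "(of_nat i :: 'p mod_ring) = of_nat j \<longleftrightarrow> [i = j] (mod p)"
  by (simp add: of_nat_eq_iff_cong_CHAR p_card)

lemma M_carrier [simp]: "M \<in> carrier_mat p p"
  using M_GL by (simp add: GL_iff)

lemma M_dim [simp]: "dim_row M = p" "dim_col M = p"
  using M_carrier by (blast dest: carrier_matD)+

lemma J_carrier [simp]: "J \<in> carrier_mat p p"
  by simp

lemma M_pow_carrier [simp]: "M ^\<^sub>m k \<in> carrier_mat p p"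
  by (rule pow_carrier_mat) simp

lemma M_pow_add: "M ^\<^sub>m (k + l) = M ^\<^sub>m k * M ^\<^sub>m l"
  by (rule pow_mat_add[OF M_carrier])

lemma M_pow_add_vec: "v \<in> V \<Longrightarrow> M ^\<^sub>m (k + l) *\<^sub>v v = M ^\<^sub>m k *\<^sub>v (M ^\<^sub>m l *\<^sub>v v)"
  by (simp add: M_pow_add assoc_mult_mat_vec[of _ p p _ p])

lemma M_pow_vec [simp]: "v \<in> V \<Longrightarrow> M ^\<^sub>m k *\<^sub>v v \<in> V"
  by (rule mult_mat_vec_carrier) simp_all

lemma J_pow_vec [simp]: "v \<in> V \<Longrightarrow> J ^\<^sub>m k *\<^sub>v v \<in> V"
  by (rule mult_mat_vec_carrier) simp_all

lemma M_pow_eq_iff: "M ^\<^sub>m k = M ^\<^sub>m l \<longleftrightarrow> [k = l] (mod q)"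
proof -
  interpret GLp: group "GL p :: 'p mod_ring mat monoid" by (rule GL_group)
  have le: "M ^\<^sub>m k = M ^\<^sub>m l \<longleftrightarrow> [k = l] (mod q)" if "k \<le> l" for k l
  proof -
    have "M [^]\<^bsub>GL p\<^esub> l = M [^]\<^bsub>GL p\<^esub> k \<otimes>\<^bsub>GL p\<^esub> M [^]\<^bsub>GL p\<^esub> (l - k)"
      using that M_GL by (simp add: GLp.nat_pow_mult)
    then have "M [^]\<^bsub>GL p\<^esub> k = M [^]\<^bsub>GL p\<^esub> l \<longleftrightarrow> M [^]\<^bsub>GL p\<^esub> (l - k) = \<one>\<^bsub>GL p\<^esub>"
      using M_GL by auto
    also have "\<dots> \<longleftrightarrow> q dvd l - k"
      using GLp.pow_eq_id[OF M_GL] M_ord by simp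
    also have "\<dots> \<longleftrightarrow> [l = k] (mod q)"
      using that by (simp add: cong_altdef_nat)
    finally show ?thesis
      by (simp add: GL_nat_pow[OF M_GL] cong_sym_eq)
  qed
  show ?thesis using le[of k l] le[of l k] by (metis cong_sym_eq nat_le_linear)
qed

lemma M_pow_q_mult: "M ^\<^sub>m (k * q) = 1\<^sub>m p"
  using M_pow_eq_iff[of "k * q" 0] by (simp add: cong_def)

text \<open>Exponents are natural numbers, so the inverse of M^k is written M^(k(q-1))
  throughout.\<close>

lemma M_pow_inverse: "M ^\<^sub>m (k + k * (q - 1)) = 1\<^sub>m p"
  using M_pow_q_mult[of k] q_pos by (cases q) auto

lemma M_pow_inverse_vec:
  assumes "v \<in> V"
  shows "M ^\<^sub>m k *\<^sub>v (M ^\<^sub>m (k * (q - 1)) *\<^sub>v v) = v"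
    "M ^\<^sub>m (k * (q - 1)) *\<^sub>v (M ^\<^sub>m k *\<^sub>v v) = v"
  using M_pow_inverse[of k] assms
  by (simp_all flip: M_pow_add_vec add: add.commute)

lemma J_pow_p: "J ^\<^sub>m p = 1\<^sub>m p"
  by (rule jordan_block_pow_card) (rule p_card)

lemma J_pow_GL: "J ^\<^sub>m i \<in> carrier (GL p)"
proof -
  have "J \<in> carrier (GL p)"
    unfolding GL_iff
  proof (intro conjI bexI[of _ "J ^\<^sub>m (p - 1)"])
    have "J ^\<^sub>m (p - 1) * J = J ^\<^sub>m p" "J * J ^\<^sub>m (p - 1) = J ^\<^sub>m p"
      using p_ge_2 pow_mat_add[OF J_carrier, of "p - 1" 1] pow_mat_add[OF J_carrier, of 1 "p - 1"]
      by simp_all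
    then show "J ^\<^sub>m (p - 1) * J = 1\<^sub>m p" "J * J ^\<^sub>m (p - 1) = 1\<^sub>m p" using J_pow_p by simp_all
  qed auto
  then show ?thesis
    using monoid.nat_pow_closed[OF group.is_monoid[OF GL_group]] by (metis GL_nat_pow)
qed

lemma J_pow_cong:
  assumes "[i = j] (mod p)" shows "J ^\<^sub>m i = J ^\<^sub>m j"
proof -
  have one: "(1\<^sub>m p :: 'p mod_ring mat) ^\<^sub>m k = 1\<^sub>m p" for k by (induct k) auto
  have "J ^\<^sub>m i = J ^\<^sub>m (i mod p)" for i
    using pow_mat_add[OF J_carrier, of "p * (i div p)" "i mod p"]
    by (simp add: pow_mat_mult[OF J_carrier] J_pow_p one)
  then show ?thesis using assms by (metis cong_def)
qed

lemma JM: "J * M = M ^\<^sub>m p * J"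
proof -
  interpret GLp: group "GL p :: 'p mod_ring mat monoid" by (rule GL_group)
  have J: "J \<in> carrier (GL p)" using J_pow_GL[of 1] by simp
  have "J \<otimes>\<^bsub>GL p\<^esub> M \<otimes>\<^bsub>GL p\<^esub> inv\<^bsub>GL p\<^esub> J = M ^\<^sub>m p"
    using J_rel by (simp add: GL_simps(2))
  then have "J \<otimes>\<^bsub>GL p\<^esub> M = M ^\<^sub>m p \<otimes>\<^bsub>GL p\<^esub> J"
    using J M_GL by (subst (asm) GLp.inv_solve_right') (auto simp flip: GL_nat_pow)
  then show ?thesis by (simp add: GL_simps(2))
qed

lemma JM_pow: "J ^\<^sub>m i * M ^\<^sub>m k = M ^\<^sub>m (k * p ^ i) * J ^\<^sub>m i"
  by (rule pow_mat_mult_commute[OF J_carrier M_carrier JM])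

lemma JM_pow_vec:
  assumes "v \<in> V"
  shows "J ^\<^sub>m i *\<^sub>v (M ^\<^sub>m k *\<^sub>v v) = M ^\<^sub>m (k * p ^ i) *\<^sub>v (J ^\<^sub>m i *\<^sub>v v)"
proof -
  have "J ^\<^sub>m i *\<^sub>v (M ^\<^sub>m k *\<^sub>v v) = (J ^\<^sub>m i * M ^\<^sub>m k) *\<^sub>v v"
    using assms by (intro assoc_mult_mat_vec[symmetric]) auto
  also have "\<dots> = M ^\<^sub>m (k * p ^ i) *\<^sub>v (J ^\<^sub>m i *\<^sub>v v)"
    unfolding JM_pow using assms by (intro assoc_mult_mat_vec) auto
  finally show ?thesis .
qed

text \<open>J is upper unitriangular, so its last row reads off the last coordinate. This makes the
  constraint w_p = i in \<open>G_set\<close> multiplicative.\<close>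

lemma J_vec_last: "w \<in> V \<Longrightarrow> (J ^\<^sub>m i *\<^sub>v w) $ (p - 1) = w $ (p - 1)"
proof (induct i arbitrary: w)
  case (Suc i)
  have Jw: "J *\<^sub>v w \<in> V" using J_pow_vec[OF Suc(2), of 1] by simp
  have "J ^\<^sub>m Suc i *\<^sub>v w = J ^\<^sub>m i *\<^sub>v (J *\<^sub>v w)"
    using Suc(2) by (simp add: assoc_mult_mat_vec[of _ p p _ p])
  moreover have "(J *\<^sub>v w) $ (p - 1) = w $ (p - 1)"
    using Suc(2) p_ge_2 by (simp add: jordan_block_mult_vec_index del: index_mult_mat_vec)
  ultimately show ?case using Suc(1)[OF Jw] by simp
qed simp

subsection \<open>The group \<open>N\<close>\<close>

lemma aff_GL_N: "v \<in> V \<Longrightarrow> aff (M ^\<^sub>m k) v \<in> carrier (GL (p + 1))"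
proof (rule aff_GL)
  show "M ^\<^sub>m k \<in> carrier (GL p)"
    using monoid.nat_pow_closed[OF group.is_monoid[OF GL_group] M_GL] by (metis GL_nat_pow M_GL)
qed

text \<open>The bound on k in the definition of N is met by reducing modulo q, which frees later
  computations from range conditions.\<close>

lemma aff_in_N [simp]:
  assumes "v \<in> V" shows "aff (M ^\<^sub>m k) v \<in> carrier N"
proof -
  have "M ^\<^sub>m k = M ^\<^sub>m (k mod q)" by (simp add: M_pow_eq_iff cong_def)
  moreover have "k mod q \<le> q - 1" using mod_less_divisor[OF q_pos, of k] by linarith
  ultimately show ?thesis using assms unfolding N_grp_def by auto
qed

lemma N_cases:
  assumes "x \<in> carrier N"
  obtains k v where "x = aff (M ^\<^sub>m k) v" "v \<in> V" "k < q"
  using assms q_pos unfolding N_grp_def by (fastforce simp: less_eq_Suc_le)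

lemma N_simps: "x \<otimes>\<^bsub>N\<^esub> y = x * y" "\<one>\<^bsub>N\<^esub> = 1\<^sub>m (p + 1)"
  by (simp_all add: N_grp_def GL_simps)

lemma aff_M_mult:
  "v \<in> V \<Longrightarrow> u \<in> V \<Longrightarrow> aff (M ^\<^sub>m k) v * aff (M ^\<^sub>m l) u = aff (M ^\<^sub>m (k + l)) (M ^\<^sub>m k *\<^sub>v u + v)"
  by (simp add: aff_mult[of _ p] M_pow_add)

lemma N_one_aff: "\<one>\<^bsub>N\<^esub> = aff (M ^\<^sub>m 0) (0\<^sub>v p)"
  by (simp add: N_simps aff_one)

lemma aff_M_inject:
  "v \<in> V \<Longrightarrow> u \<in> V \<Longrightarrow> aff (M ^\<^sub>m k) v = aff (M ^\<^sub>m l) u \<longleftrightarrow> [k = l] (mod q) \<and> v = u"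
  by (simp add: aff_inject[of _ p] M_pow_eq_iff)

lemma N_subgroup: "subgroup (carrier N) (GL (p + 1))"
proof -
  interpret L: group "GL (p + 1) :: 'p mod_ring mat monoid" by (rule GL_group)
  show ?thesis
  proof (rule L.subgroupI)
    show "carrier N \<subseteq> carrier (GL (p + 1))"
      using aff_GL_N by (auto elim!: N_cases)
    show "carrier N \<noteq> {}" using aff_in_N[of "0\<^sub>v p" 0] by auto
  next
    fix x assume "x \<in> carrier N"
    then obtain k v where x: "x = aff (M ^\<^sub>m k) v" "v \<in> V" by (rule N_cases)
    \<comment> \<open>The inverse of x -> M^k x + v is x -> M^(-k) x - M^(-k) v, with -k replaced by
      k(q-1).\<close>
    let ?l = "k * (q - 1)"
    let ?u = "- (M ^\<^sub>m ?l *\<^sub>v v)"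
    have u: "?u \<in> V" using x by simp
    have "M ^\<^sub>m ?l *\<^sub>v v + ?u = 0\<^sub>v p"
      using x by (intro eq_vecI) auto
    then have "aff (M ^\<^sub>m ?l) ?u * x = 1\<^sub>m (p + 1)"
      using aff_M_mult[OF u x(2), of ?l k] M_pow_inverse[of k]
      by (simp only: x(1) add.commute[of _ k] aff_one)
    then have "inv\<^bsub>GL (p + 1)\<^esub> x = aff (M ^\<^sub>m ?l) ?u"
      using x u by (intro L.inv_equality) (auto simp: GL_simps(2,3) aff_GL_N simp del: One_nat_def)
    then show "inv\<^bsub>GL (p + 1)\<^esub> x \<in> carrier N" using u by simp
  next
    fix x y assume "x \<in> carrier N" "y \<in> carrier N"
    then show "x \<otimes>\<^bsub>GL (p + 1)\<^esub> y \<in> carrier N"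
      by (auto elim!: N_cases simp: GL_simps(2) aff_M_mult)
  qed
qed

sublocale N: group N
proof -
  have "N = (GL (p + 1))\<lparr>carrier := carrier N\<rparr>" by (simp add: N_grp_def)
  then show "group N"
    using subgroup.subgroup_is_group[OF N_subgroup GL_group] by simp
qed

lemma N_bij: "bij_betw (\<lambda>(k, v). aff (M ^\<^sub>m k) v) ({..<q} \<times> V) (carrier N)"
proof (rule bij_betwI')
  fix x y assume "x \<in> {..<q} \<times> V" "y \<in> {..<q} \<times> V"
  then show "((\<lambda>(k, v). aff (M ^\<^sub>m k) v) x = (\<lambda>(k, v). aff (M ^\<^sub>m k) v) y) = (x = y)"
    by (auto simp: aff_M_inject cong_less_modulus_unique_nat)
next
  fix y assume "y \<in> carrier N"
  then obtain k v where "y = aff (M ^\<^sub>m k) v" "v \<in> V" "k < q" by (rule N_cases)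
  then show "\<exists>x\<in>{..<q} \<times> V. y = (\<lambda>(k, v). aff (M ^\<^sub>m k) v) x" by auto
qed auto

lemma card_N: "card (carrier N) = p ^ p * q"
  using bij_betw_same_card[OF N_bij] by (simp add: card_cartesian_product card_V mult.commute)

lemma finite_N: "finite (carrier N)"
  using bij_betw_finite[OF N_bij] by simp

subsection \<open>Conjugation automorphisms\<close>

lemma conj_N_eqI:
  assumes "S \<in> carrier (GL (p + 1))" "R \<in> carrier N" "R' \<in> carrier N" "S * R = R' * S"
  shows "conj_N p q M S R = R'"
proof -
  interpret L: group "GL (p + 1) :: 'p mod_ring mat monoid" by (rule GL_group)
  have "R \<in> carrier (GL (p + 1))" "R' \<in> carrier (GL (p + 1))"
    using assms subgroup.subset[OF N_subgroup] by auto
  moreover have "S \<otimes>\<^bsub>GL (p + 1)\<^esub> R = R' \<otimes>\<^bsub>GL (p + 1)\<^esub> S"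
    using assms by (simp add: GL_simps(2))
  ultimately show ?thesis
    using assms by (simp add: conj_N_def L.inv_solve_right' del: One_nat_def)
qed

lemma conj_N_auto:
  assumes S: "S \<in> carrier (GL (p + 1))"
    and maps: "\<And>R. R \<in> carrier N \<Longrightarrow> conj_N p q M S R \<in> carrier N"
  shows "conj_N p q M S \<in> auto N"
proof -
  interpret L: group "GL (p + 1) :: 'p mod_ring mat monoid" by (rule GL_group)
  have sub: "R \<in> carrier (GL (p + 1))" if "R \<in> carrier N" for R
    using that subgroup.subset[OF N_subgroup] by auto
  have conj: "conj_N p q M S R = S \<otimes>\<^bsub>GL (p + 1)\<^esub> R \<otimes>\<^bsub>GL (p + 1)\<^esub> inv\<^bsub>GL (p + 1)\<^esub> S"
    if "R \<in> carrier N" for R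
    using that by (simp add: conj_N_def)
  have multN: "R \<otimes>\<^bsub>N\<^esub> R' = R \<otimes>\<^bsub>GL (p + 1)\<^esub> R'" for R R'
    by (simp add: N_simps GL_simps(2))
  have "conj_N p q M S \<in> hom N N"
  proof (rule homI)
    fix R R' assume R: "R \<in> carrier N" "R' \<in> carrier N"
    have cancel: "inv\<^bsub>GL (p + 1)\<^esub> S \<otimes>\<^bsub>GL (p + 1)\<^esub> (S \<otimes>\<^bsub>GL (p + 1)\<^esub> X) = X"
      if "X \<in> carrier (GL (p + 1))" for X
      using S that by (simp del: One_nat_def flip: L.m_assoc)
    have "S \<otimes>\<^bsub>GL (p + 1)\<^esub> R \<otimes>\<^bsub>GL (p + 1)\<^esub> inv\<^bsub>GL (p + 1)\<^esub> S \<otimes>\<^bsub>GL (p + 1)\<^esub>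
       (S \<otimes>\<^bsub>GL (p + 1)\<^esub> R' \<otimes>\<^bsub>GL (p + 1)\<^esub> inv\<^bsub>GL (p + 1)\<^esub> S)
       = S \<otimes>\<^bsub>GL (p + 1)\<^esub> (R \<otimes>\<^bsub>GL (p + 1)\<^esub> R') \<otimes>\<^bsub>GL (p + 1)\<^esub> inv\<^bsub>GL (p + 1)\<^esub> S"
      using S sub R by (simp add: L.m_assoc cancel del: One_nat_def)
    then show "conj_N p q M S (R \<otimes>\<^bsub>N\<^esub> R') = conj_N p q M S R \<otimes>\<^bsub>N\<^esub> conj_N p q M S R'"
      using R N.m_closed[OF R] by (simp only: conj multN)
  qed (rule maps)
  moreover have inj: "inj_on (conj_N p q M S) (carrier N)"
    using S sub by (intro inj_onI) (simp add: conj del: One_nat_def)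
  \<comment> \<open>Finiteness of N upgrades an injective self-map to a bijection, so S only has to
    conjugate N into itself.\<close>
  moreover have "conj_N p q M S ` carrier N = carrier N"
    using maps inj finite_N by (intro endo_inj_surj) auto
  ultimately show ?thesis
    by (simp add: auto_def Bij_def bij_betw_def conj_N_def)
qed

text \<open>\<open>conj_N\<close> is cut off outside N, so the inner map must land in N before the
  two conjugations can be merged.\<close>

lemma conj_N_compose:
  assumes S: "S \<in> carrier (GL (p + 1))" "S' \<in> carrier (GL (p + 1))"
    and maps: "\<And>R. R \<in> carrier N \<Longrightarrow> conj_N p q M S' R \<in> carrier N"
  shows "compose (carrier N) (conj_N p q M S) (conj_N p q M S') = conj_N p q M (S * S')"
proof -
  interpret L: group "GL (p + 1) :: 'p mod_ring mat monoid" by (rule GL_group)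
  have sub: "R \<in> carrier (GL (p + 1))" if "R \<in> carrier N" for R
    using that subgroup.subset[OF N_subgroup] by auto
  have SS: "S * S' = S \<otimes>\<^bsub>GL (p + 1)\<^esub> S'" by (simp add: GL_simps(2))
  show ?thesis
  proof (rule extensionalityI[of _ "carrier N"])
    fix R assume R: "R \<in> carrier N"
    have "conj_N p q M S' R = S' \<otimes>\<^bsub>GL (p + 1)\<^esub> R \<otimes>\<^bsub>GL (p + 1)\<^esub> inv\<^bsub>GL (p + 1)\<^esub> S'"
      using R by (simp add: conj_N_def)
    then show "compose (carrier N) (conj_N p q M S) (conj_N p q M S') R = conj_N p q M (S * S') R"
      unfolding SS compose_eq[OF R] using R S sub maps[OF R]
      by (simp add: conj_N_def L.m_assoc L.inv_mult_group del: One_nat_def)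
  qed (auto simp: compose_def conj_N_def)
qed

text \<open>The sign follows Y and Z, which pair a translation by v with conjugation by a map
  translating by -v.\<close>

definition twist :: "nat \<Rightarrow> 'p mod_ring vec \<Rightarrow> 'p mod_ring mat \<Rightarrow> 'p mod_ring mat" where
  "twist i w = conj_N p q M (aff (J ^\<^sub>m i) (- w))"

lemma aff_J_GL: "w \<in> V \<Longrightarrow> aff (J ^\<^sub>m i) (- w) \<in> carrier (GL (p + 1))"
  by (rule aff_GL[OF J_pow_GL]) simp

text \<open>The image R' solves SR = R'S: the linear parts J^i M^k = M^(k p^i) J^i give the
  exponent, the translation parts then give the vector.\<close>

lemma twist_aff:
  assumes "v \<in> V" "w \<in> V"
  shows "twist i w (aff (M ^\<^sub>m k) v) =
    aff (M ^\<^sub>m (k * p ^ i)) (J ^\<^sub>m i *\<^sub>v v - w + M ^\<^sub>m (k * p ^ i) *\<^sub>v w)"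
  unfolding twist_def
proof (rule conj_N_eqI)
  let ?l = "k * p ^ i"
  let ?u = "J ^\<^sub>m i *\<^sub>v v - w + M ^\<^sub>m ?l *\<^sub>v w"
  have u: "?u \<in> V" using assms by simp
  have "aff (J ^\<^sub>m i) (- w) * aff (M ^\<^sub>m k) v = aff (J ^\<^sub>m i * M ^\<^sub>m k) (J ^\<^sub>m i *\<^sub>v v + - w)"
    using assms by (intro aff_mult[of _ p]) auto
  moreover have "aff (M ^\<^sub>m ?l) ?u * aff (J ^\<^sub>m i) (- w) = aff (M ^\<^sub>m ?l * J ^\<^sub>m i) (M ^\<^sub>m ?l *\<^sub>v (- w) + ?u)"
    using assms u by (intro aff_mult[of _ p]) auto
  moreover have "M ^\<^sub>m ?l *\<^sub>v (- w) = - (M ^\<^sub>m ?l *\<^sub>v w)"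
    using assms by (intro mult_mat_vec_uminus[of _ p p]) auto
  moreover have "- (M ^\<^sub>m ?l *\<^sub>v w) + ?u = J ^\<^sub>m i *\<^sub>v v + - w"
    using assms M_pow_vec[OF assms(2), of ?l] J_pow_vec[OF assms(1), of i]
    by (intro eq_vecI) (auto simp del: index_mult_mat_vec)
  ultimately show "aff (J ^\<^sub>m i) (- w) * aff (M ^\<^sub>m k) v = aff (M ^\<^sub>m ?l) ?u * aff (J ^\<^sub>m i) (- w)"
    by (simp add: JM_pow)
qed (use assms aff_J_GL in auto)

lemma twist_closed: "w \<in> V \<Longrightarrow> R \<in> carrier N \<Longrightarrow> twist i w R \<in> carrier N"
  by (auto elim!: N_cases simp: twist_aff)

lemma twist_auto: "w \<in> V \<Longrightarrow> twist i w \<in> auto N"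
  using conj_N_auto[OF aff_J_GL] twist_closed unfolding twist_def by blast

lemma twist_mult:
  assumes "w \<in> V" "w' \<in> V"
  shows "twist i w \<otimes>\<^bsub>AutoGroup N\<^esub> twist i' w' = twist (i + i') (w + J ^\<^sub>m i *\<^sub>v w')"
proof -
  have "aff (J ^\<^sub>m i) (- w) * aff (J ^\<^sub>m i') (- w') = aff (J ^\<^sub>m i * J ^\<^sub>m i') (J ^\<^sub>m i *\<^sub>v (- w') + - w)"
    using assms by (intro aff_mult[of _ p]) auto
  also have "J ^\<^sub>m i *\<^sub>v (- w') = - (J ^\<^sub>m i *\<^sub>v w')"
    using assms by (intro mult_mat_vec_uminus[of _ p p]) auto
  also have "- (J ^\<^sub>m i *\<^sub>v w') + - w = - (w + J ^\<^sub>m i *\<^sub>v w')"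
    using assms J_pow_vec[OF assms(2), of i] by (intro eq_vecI) (auto simp del: index_mult_mat_vec)
  also have "J ^\<^sub>m i * J ^\<^sub>m i' = J ^\<^sub>m (i + i')"
    by (rule pow_mat_add[OF J_carrier, symmetric])
  finally show ?thesis
    using conj_N_compose[OF aff_J_GL[OF assms(1), of i] aff_J_GL[OF assms(2), of i']]
      twist_closed[OF assms(2)] twist_auto assms
    by (simp add: AutoGroup_mult twist_def)
qed

lemma twist_zero: "twist 0 (0\<^sub>v p) = \<one>\<^bsub>AutoGroup N\<^esub>"
proof -
  have "twist 0 (0\<^sub>v p) R = R" if "R \<in> carrier N" for R
    using that by (auto elim!: N_cases simp: twist_aff mult_mat_vec_zero[OF M_pow_carrier])
  then have "twist 0 (0\<^sub>v p) = (\<lambda>x\<in>carrier N. x)"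
    using auto_memD(3)[OF twist_auto[of "0\<^sub>v p" 0]]
    by (intro extensionalityI[of _ "carrier N"]) auto
  then show ?thesis by (simp add: AutoGroup_def BijGroup_def)
qed

subsection \<open>The elements of \<open>G\<close>\<close>

text \<open>As a pair \<open>(RS, S)\<close> of affine maps, this is \<open>((M\<^sup>k J\<^sup>i, 0), (J\<^sup>i, -w))\<close>.\<close>

definition hol_elem ::
    "nat \<Rightarrow> nat \<Rightarrow> 'p mod_ring vec \<Rightarrow> 'p mod_ring mat \<times> ('p mod_ring mat \<Rightarrow> 'p mod_ring mat)" where
  "hol_elem k i w = (aff (M ^\<^sub>m k) (M ^\<^sub>m k *\<^sub>v w), twist i w)"

sublocale Hol: group "Hol N"
  by (rule N.Hol_group)

lemma hol_elem_closed [simp]: "w \<in> V \<Longrightarrow> hol_elem k i w \<in> carrier (Hol N)"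
  by (simp add: hol_elem_def Hol_simps twist_auto)

text \<open>In the pair coordinates this is M^k J^i M^k' J^i' = M^(k + k' p^i) J^(i+i') together
  with the product of (J^i, -w) and (J^i', -w').\<close>

lemma hol_elem_mult:
  assumes "w \<in> V" "w' \<in> V"
  shows "hol_elem k i w \<otimes>\<^bsub>Hol N\<^esub> hol_elem k' i' w' =
    hol_elem (k + k' * p ^ i) (i + i') (w + J ^\<^sub>m i *\<^sub>v w')"
proof -
  let ?l = "k' * p ^ i"
  let ?x = "J ^\<^sub>m i *\<^sub>v w'"
  have x: "?x \<in> V" using assms by simp
  have "twist i w (aff (M ^\<^sub>m k') (M ^\<^sub>m k' *\<^sub>v w')) =
      aff (M ^\<^sub>m ?l) (M ^\<^sub>m ?l *\<^sub>v ?x - w + M ^\<^sub>m ?l *\<^sub>v w)"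
    using assms by (simp add: twist_aff JM_pow_vec)
  moreover have "aff (M ^\<^sub>m k) (M ^\<^sub>m k *\<^sub>v w) \<otimes>\<^bsub>N\<^esub> aff (M ^\<^sub>m ?l) (M ^\<^sub>m ?l *\<^sub>v ?x - w + M ^\<^sub>m ?l *\<^sub>v w) =
      aff (M ^\<^sub>m (k + ?l)) (M ^\<^sub>m k *\<^sub>v (M ^\<^sub>m ?l *\<^sub>v ?x - w + M ^\<^sub>m ?l *\<^sub>v w) + M ^\<^sub>m k *\<^sub>v w)"
    using assms x by (simp add: N_simps aff_M_mult)
  moreover have "M ^\<^sub>m k *\<^sub>v (M ^\<^sub>m ?l *\<^sub>v ?x - w + M ^\<^sub>m ?l *\<^sub>v w) + M ^\<^sub>m k *\<^sub>v w =
      M ^\<^sub>m (k + ?l) *\<^sub>v (w + ?x)"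
  proof -
    have "M ^\<^sub>m k *\<^sub>v (M ^\<^sub>m ?l *\<^sub>v ?x - w + M ^\<^sub>m ?l *\<^sub>v w) =
        M ^\<^sub>m k *\<^sub>v (M ^\<^sub>m ?l *\<^sub>v ?x) - M ^\<^sub>m k *\<^sub>v w + M ^\<^sub>m k *\<^sub>v (M ^\<^sub>m ?l *\<^sub>v w)"
      using assms x
      by (simp add: mult_add_distrib_mat_vec[OF M_pow_carrier] mult_minus_distrib_mat_vec[OF M_pow_carrier])
    moreover have "M ^\<^sub>m (k + ?l) *\<^sub>v (w + ?x) =
        M ^\<^sub>m k *\<^sub>v (M ^\<^sub>m ?l *\<^sub>v w) + M ^\<^sub>m k *\<^sub>v (M ^\<^sub>m ?l *\<^sub>v ?x)"
      using assms x
      by (simp add: mult_add_distrib_mat_vec[OF M_pow_carrier] M_pow_add_vec)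
    \<comment> \<open>Here b is M^k w: the translation part of the first component cancels the -w
      coming from the conjugation.\<close>
    moreover have "a - b + c + b = c + a" if "a \<in> V" "b \<in> V" "c \<in> V" for a b c
      using that by (intro eq_vecI) auto
    ultimately show ?thesis using assms x by simp
  qed
  ultimately show ?thesis
    using assms by (simp add: hol_elem_def Hol_simps twist_mult)
qed

lemma hol_elem_one: "hol_elem 0 0 (0\<^sub>v p) = \<one>\<^bsub>Hol N\<^esub>"
  by (simp add: hol_elem_def Hol_simps twist_zero N_one_aff)

lemma hol_elem_cong:
  assumes "[k = k'] (mod q)" "[i = i'] (mod p)"
  shows "hol_elem k i w = hol_elem k' i' w"
proof -
  have "M ^\<^sub>m k = M ^\<^sub>m k'" using assms by (simp add: M_pow_eq_iff)
  then show ?thesis using J_pow_cong[OF assms(2)] by (simp add: hol_elem_def twist_def)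
qed

text \<open>Index p - 1 is the coordinate w_p. Since i matters only modulo p, w determines it,
  leaving k modulo q and w as free parameters.\<close>

definition G_set :: "('p mod_ring mat \<times> ('p mod_ring mat \<Rightarrow> 'p mod_ring mat)) set" where
  "G_set = {hol_elem k i w | k i w. w \<in> V \<and> w $ (p - 1) = of_nat i}"

lemma vec_last_add: "w \<in> V \<Longrightarrow> w' \<in> V \<Longrightarrow> (w + w') $ (p - 1) = w $ (p - 1) + w' $ (p - 1)"
  using p_ge_2 by simp

lemma G_set_subgroup: "subgroup G_set (Hol N)"
proof (rule Hol.subgroupI)
  show "G_set \<subseteq> carrier (Hol N)" by (auto simp: G_set_def)
  have "hol_elem 0 0 (0\<^sub>v p) \<in> G_set"
    using p_ge_2 unfolding G_set_def by (auto intro!: exI[of _ 0])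
  then show "G_set \<noteq> {}" by blast
next
  fix x assume "x \<in> G_set"
  then obtain k i w where x: "x = hol_elem k i w" "w \<in> V" "w $ (p - 1) = of_nat i"
    by (auto simp: G_set_def)
  \<comment> \<open>In natural numbers j stands for -i modulo p, and l for -k p^(-i) modulo q: q - 1
    is -1, and p^j inverts p^i because p^(i+j) = (p^p)^i is 1 modulo q. Finally u is -J^(-i)
    w.\<close>
  define j where "j = i * (p - 1)"
  define l where "l = k * (q - 1) * p ^ j"
  define u where "u = - (J ^\<^sub>m j *\<^sub>v w)"
  have Jw: "J ^\<^sub>m j *\<^sub>v w \<in> V" using x by simp
  have u: "u \<in> V" using Jw by (simp add: u_def)
  have j: "i + j = p * i" "[i + j = 0] (mod p)"
    using p_ge_2 by (simp_all add: j_def cong_def algebra_simps flip: mult_Suc)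
  have "[(p ^ p) ^ i = 1 ^ i] (mod q)"
    using repunit_facts(1) p_ge_2 by (intro cong_pow) (subst cong_altdef_nat, auto)
  then have "[k + k * (q - 1) * (p ^ p) ^ i = k + k * (q - 1) * 1 ^ i] (mod q)"
    by (intro cong_add cong_mult) simp_all
  moreover have "k + l * p ^ i = k + k * (q - 1) * (p ^ p) ^ i"
    by (simp add: l_def mult.assoc add.commute[of j] j(1) flip: power_add power_mult)
  moreover have "k + k * (q - 1) = k * q"
    using q_pos by (cases q) auto
  ultimately have "[k + l * p ^ i = 0] (mod q)"
    by (simp add: cong_def)
  moreover have "w + J ^\<^sub>m i *\<^sub>v u = 0\<^sub>v p"
  proof -
    have "J ^\<^sub>m i *\<^sub>v u = - (J ^\<^sub>m i *\<^sub>v (J ^\<^sub>m j *\<^sub>v w))"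
      unfolding u_def by (rule mult_mat_vec_uminus[OF jordan_block_pow_carrier Jw])
    also have "J ^\<^sub>m i *\<^sub>v (J ^\<^sub>m j *\<^sub>v w) = J ^\<^sub>m (i + j) *\<^sub>v w"
      using x(2) by (simp add: pow_mat_add[OF J_carrier] assoc_mult_mat_vec[of _ p p _ p])
    also have "J ^\<^sub>m (i + j) = 1\<^sub>m p"
      using J_pow_cong[OF j(2)] by simp
    finally show ?thesis using x(2) by (intro eq_vecI) auto
  qed
  ultimately have "hol_elem k i w \<otimes>\<^bsub>Hol N\<^esub> hol_elem l j u = \<one>\<^bsub>Hol N\<^esub>"
    using x u j hol_elem_cong[of "k + l * p ^ i" 0 "i + j" 0] by (simp add: hol_elem_mult hol_elem_one)
  then have "inv\<^bsub>Hol N\<^esub> x = hol_elem l j u"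
    using x u by (metis Hol.inv_equality Hol.inv_comm hol_elem_closed)
  moreover have "u $ (p - 1) = of_nat j"
  proof -
    have "(of_nat i + of_nat j :: 'p mod_ring) = 0"
      using j(2) of_nat_eq_iff_cong[of "i + j" 0] by simp
    moreover have "u $ (p - 1) = - of_nat i"
      using Jw x p_ge_2 J_vec_last[OF x(2), of j]
      by (simp add: u_def del: index_mult_mat_vec)
    ultimately show ?thesis by (metis minus_unique)
  qed
  ultimately show "inv\<^bsub>Hol N\<^esub> x \<in> G_set" using u by (auto simp: G_set_def)
next
  fix x y assume "x \<in> G_set" "y \<in> G_set"
  then obtain k i w k' i' w' where xy: "x = hol_elem k i w" "w \<in> V" "w $ (p - 1) = of_nat i"
    "y = hol_elem k' i' w'" "w' \<in> V" "w' $ (p - 1) = of_nat i'"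
    by (auto simp: G_set_def)
  have "(w + J ^\<^sub>m i *\<^sub>v w') $ (p - 1) = of_nat (i + i')"
    using xy J_vec_last by (subst vec_last_add) auto
  then show "x \<otimes>\<^bsub>Hol N\<^esub> y \<in> G_set"
    using xy unfolding G_set_def by (auto simp: hol_elem_mult intro!: exI)
qed

subsection \<open>Generation of \<open>G\<close>\<close>

lemma e_vec_last: "e_vec p p \<in> V" "e_vec p p $ (p - 1) = (1 :: 'p mod_ring)"
  using p_ge_2 by (auto simp: e_vec_def)

lemma X_elem_eq: "X_elem p q M = hol_elem 1 0 (0\<^sub>v p)"
  by (simp add: X_elem_def hol_elem_def twist_def mult_mat_vec_zero[OF M_carrier])

lemma Y_elem_eq: "u \<in> V \<Longrightarrow> Y_elem p q M u = hol_elem 0 0 u"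
  by (simp add: Y_elem_def hol_elem_def twist_def)

lemma Z_elem_eq: "Z_elem p q M = hol_elem 0 1 (e_vec p p)"
  using e_vec_last by (simp add: Z_elem_def hol_elem_def twist_def)

text \<open>The vectors u with Y_u in K form a J-stable subspace D containing e_(p-1). As (J - I)
  e_j = e_(j-1), D contains e_1, ..., e_(p-1), which span the hyperplane u_p = 0.\<close>

lemma translations_generated:
  assumes K: "subgroup K (Hol N)"
    and Y: "hol_elem 0 0 (e_vec p (p - 1)) \<in> K" and Z: "hol_elem 0 1 (e_vec p p) \<in> K"
    and u: "u \<in> V" "u $ (p - 1) = 0"
  shows "hol_elem 0 0 u \<in> K"
proof -
  interpret K: subgroup K "Hol N" by (rule K)
  define D where "D = {u \<in> V. hol_elem 0 0 u \<in> K}"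
  have D_add: "v + w \<in> D" if "v \<in> D" "w \<in> D" for v w
  proof -
    have vw: "v \<in> V" "w \<in> V" "hol_elem 0 0 v \<in> K" "hol_elem 0 0 w \<in> K"
      using that by (auto simp: D_def)
    then have "hol_elem 0 0 v \<otimes>\<^bsub>Hol N\<^esub> hol_elem 0 0 w = hol_elem 0 0 (v + w)"
      by (simp add: hol_elem_mult)
    then show ?thesis using K.m_closed[OF vw(3,4)] vw by (simp add: D_def)
  qed
  have D_zero: "0\<^sub>v p \<in> D"
    by (simp add: D_def hol_elem_one)
  have D_neg: "- v \<in> D" if "v \<in> D" for v
  proof -
    have v: "v \<in> V" "hol_elem 0 0 v \<in> K" using that by (auto simp: D_def)
    have "- v + v = 0\<^sub>v p" using v by (intro eq_vecI) auto
    then have "inv\<^bsub>Hol N\<^esub> (hol_elem 0 0 v) = hol_elem 0 0 (- v)"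
      using v by (intro Hol.inv_equality) (simp_all add: hol_elem_mult hol_elem_one)
    then show ?thesis using v K.m_inv_closed by (fastforce simp: D_def)
  qed
  \<comment> \<open>Conjugation by Z sends Y_v to Y_(Jv).\<close>
  have D_J: "J *\<^sub>v v \<in> D" if "v \<in> D" for v
  proof -
    have v: "v \<in> V" "hol_elem 0 0 v \<in> K" using that by (auto simp: D_def)
    have Jv: "J *\<^sub>v v \<in> V" using J_pow_vec[OF v(1), of 1] by simp
    have "e_vec p p + J *\<^sub>v v = J *\<^sub>v v + e_vec p p"
      using e_vec_last Jv by (intro comm_add_vec)
    then have "hol_elem 0 1 (e_vec p p) \<otimes>\<^bsub>Hol N\<^esub> hol_elem 0 0 v =
      hol_elem 0 0 (J *\<^sub>v v) \<otimes>\<^bsub>Hol N\<^esub> hol_elem 0 1 (e_vec p p)"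
      using v Jv e_vec_last by (simp add: hol_elem_mult)
    then have "hol_elem 0 0 (J *\<^sub>v v) = hol_elem 0 1 (e_vec p p) \<otimes>\<^bsub>Hol N\<^esub> hol_elem 0 0 v \<otimes>\<^bsub>Hol N\<^esub>
        inv\<^bsub>Hol N\<^esub> hol_elem 0 1 (e_vec p p)"
      using v Jv e_vec_last by (subst Hol.inv_solve_right) auto
    then have "hol_elem 0 0 (J *\<^sub>v v) \<in> K"
      using K.m_closed K.m_inv_closed Z v by metis
    then show ?thesis using Jv by (simp add: D_def)
  qed
  have D_smult: "c \<cdot>\<^sub>v v \<in> D" if "v \<in> D" for c v
  proof -
    have v: "v \<in> V" using that by (auto simp: D_def)
    \<comment> \<open>Every scalar of the prime field is a multiple of 1, so closure under addition
      is enough.\<close>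
    have "of_nat m \<cdot>\<^sub>v v \<in> D" for m
    proof (induct m)
      case 0
      have "of_nat 0 \<cdot>\<^sub>v v = 0\<^sub>v p" using v by (intro eq_vecI) auto
      then show ?case using D_zero by simp
    next
      case (Suc m)
      have "of_nat (Suc m) \<cdot>\<^sub>v v = v + of_nat m \<cdot>\<^sub>v v"
        by (intro eq_vecI) (auto simp: algebra_simps)
      then show ?case using D_add[OF that Suc] by simp
    qed
    then show ?thesis using surj_of_nat_mod_ring by metis
  qed
  \<comment> \<open>Numbering from 0, the starting vector e_(p-1) is
    \<open>unit_vec p (p - 2)\<close>; the induction descends from it.\<close>
  have D_unit: "unit_vec p j \<in> D" if "j \<le> p - 2" for j
    using that
  proof (induct j rule: inc_induct)
    case base
    show ?case using Y by (simp add: D_def e_vec_def numeral_2_eq_2)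
  next
    case (step j)
    have uV: "unit_vec p (Suc j) \<in> V" by simp
    have "J *\<^sub>v unit_vec p (Suc j) + - unit_vec p (Suc j) = unit_vec p j"
    proof (rule eq_vecI)
      fix i assume "i < dim_vec (unit_vec p j :: 'p mod_ring vec)"
      then have "i < p" by simp
      moreover have "Suc j < p" using step by simp
      ultimately show "(J *\<^sub>v unit_vec p (Suc j) + - unit_vec p (Suc j)) $ i = unit_vec p j $ i"
        by (auto simp: jordan_block_mult_vec_index[OF uV] simp del: index_mult_mat_vec)
    qed simp
    then show ?case using D_add[OF D_J D_neg] step by metis
  qed
  \<comment> \<open>Here m bounds the support of v, and each step clears its highest
    coordinate.\<close>
  have "v \<in> D" if "m \<le> p - 1" "v \<in> V" "\<And>j. m \<le> j \<Longrightarrow> j < p \<Longrightarrow> v $ j = 0" for m v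
    using that
  proof (induct m arbitrary: v)
    case 0
    then have "v = 0\<^sub>v p" by (intro eq_vecI) auto
    then show ?case using D_zero by simp
  next
    case (Suc m)
    let ?a = "v $ m \<cdot>\<^sub>v unit_vec p m"
    have m: "m < p" "m \<le> p - 2" using Suc.prems(1) by auto
    have "v - ?a \<in> D"
    proof (rule Suc.hyps)
      fix j assume "m \<le> j" "j < p"
      then show "(v - ?a) $ j = 0"
        using Suc.prems m by (cases "j = m") auto
    qed (use Suc.prems in auto)
    moreover have "?a \<in> D" using D_smult D_unit m by simp
    ultimately have "(v - ?a) + ?a \<in> D" by (rule D_add)
    moreover have "(v - ?a) + ?a = v"
      using Suc.prems by (intro eq_vecI) auto
    ultimately show ?case by simp
  qed
  note D_all = this
  have "u $ j = 0" if "p - 1 \<le> j" "j < p" for j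
  proof -
    have "j = p - 1" using that by linarith
    then show ?thesis using u by simp
  qed
  then have "u \<in> D" using D_all[of "p - 1" u] u by simp
  then show ?thesis by (simp add: D_def)
qed

text \<open>Left factors X account for k. A right factor Z lowers i by one and removes J^i e_p from
  w, whose last coordinate drops by 1; at i = 0 a translation with w_p = 0 remains.\<close>

lemma G_set_generated:
  assumes K: "subgroup K (Hol N)" and X: "hol_elem 1 0 (0\<^sub>v p) \<in> K"
    and Y: "hol_elem 0 0 (e_vec p (p - 1)) \<in> K" and Z: "hol_elem 0 1 (e_vec p p) \<in> K"
    and w: "w \<in> V" "w $ (p - 1) = of_nat i"
  shows "hol_elem k i w \<in> K"
proof (induct k)
  case 0
  show ?case using w
  proof (induct i arbitrary: w)
    case 0
    then show ?case using translations_generated[OF K Y Z] by simp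
  next
    case (Suc i)
    let ?e = "J ^\<^sub>m i *\<^sub>v e_vec p p"
    have e: "?e \<in> V" "?e $ (p - 1) = 1" using e_vec_last J_vec_last by simp_all
    have "(w - ?e) $ (p - 1) = of_nat i"
      using Suc.prems e p_ge_2 by (simp del: index_mult_mat_vec)
    then have "hol_elem 0 i (w - ?e) \<in> K"
      using Suc e by simp
    moreover have "w - ?e + ?e = w" using Suc.prems e by (intro eq_vecI) auto
    moreover have "hol_elem 0 i (w - ?e) \<otimes>\<^bsub>Hol N\<^esub> hol_elem 0 1 (e_vec p p) = hol_elem 0 (Suc i) (w - ?e + ?e)"
      using Suc.prems e e_vec_last by (subst hol_elem_mult) auto
    ultimately show ?case
      using subgroup.m_closed[OF K _ Z] by metis
  qed
next
  case (Suc k)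
  have "hol_elem 1 0 (0\<^sub>v p) \<otimes>\<^bsub>Hol N\<^esub> hol_elem k i w = hol_elem (Suc k) i w"
    using w by (simp add: hol_elem_mult)
  then show ?case using subgroup.m_closed[OF K X Suc] by simp
qed

lemma G_sub_eq: "G_sub p q M = G_set"
proof -
  have eY: "e_vec p (p - 1) \<in> V" "e_vec p (p - 1) $ (p - 1) = (0 :: 'p mod_ring)"
    using p_ge_2 by (auto simp: e_vec_def)
  have in_G: "hol_elem k i w \<in> G_set" if "w \<in> V" "w $ (p - 1) = of_nat i" for k i w
    using that by (auto simp: G_set_def)
  let ?S = "{hol_elem 1 0 (0\<^sub>v p), hol_elem 0 0 (e_vec p (p - 1)), hol_elem 0 1 (e_vec p p)}"
  have G: "G_sub p q M = generate (Hol N) ?S"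
    using eY by (simp add: G_sub_def X_elem_eq Y_elem_eq Z_elem_eq del: One_nat_def)
  have sub: "?S \<subseteq> G_set"
    using in_G eY e_vec_last p_ge_2 by simp
  then have K: "subgroup (generate (Hol N) ?S) (Hol N)"
    using subgroup.subset[OF G_set_subgroup] by (intro Hol.generate_is_subgroup) blast
  show ?thesis
  proof
    show "G_sub p q M \<subseteq> G_set"
      unfolding G by (rule Hol.generate_subgroup_incl[OF sub G_set_subgroup])
    show "G_set \<subseteq> G_sub p q M"
    proof
      fix g assume "g \<in> G_set"
      then obtain k i w where g: "g = hol_elem k i w" "w \<in> V" "w $ (p - 1) = of_nat i"
        unfolding G_set_def by blast
      show "g \<in> G_sub p q M"
        unfolding G g(1) by (rule G_set_generated[OF K _ _ _ g(2,3)]) (auto intro: generate.incl)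
    qed
  qed
qed

text \<open>A first component (M^k, v) fixes k modulo q and w = M^(-k) v, and w_p then fixes i
  modulo p.\<close>

lemma G_set_regular: "regular_subgroup G_set N"
  unfolding N.regular_subgroup_iff
proof (intro conjI ballI G_set_subgroup)
  fix \<eta> assume "\<eta> \<in> carrier N"
  then obtain k v where \<eta>: "\<eta> = aff (M ^\<^sub>m k) v" "v \<in> V" by (rule N_cases)
  define w where "w = M ^\<^sub>m (k * (q - 1)) *\<^sub>v v"
  have w: "w \<in> V" "M ^\<^sub>m k *\<^sub>v w = v"
    using \<eta> M_pow_inverse_vec by (auto simp: w_def)
  obtain i where i: "w $ (p - 1) = of_nat i" using surj_of_nat_mod_ring by blast
  show "\<exists>!g. g \<in> G_set \<and> fst g = \<eta>"
  proof (rule ex1I[of _ "hol_elem k i w"])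
    show "hol_elem k i w \<in> G_set \<and> fst (hol_elem k i w) = \<eta>"
      using w i by (auto simp: G_set_def \<eta> hol_elem_def)
    fix g assume "g \<in> G_set \<and> fst g = \<eta>"
    then obtain k' i' w' where g: "g = hol_elem k' i' w'" "w' \<in> V" "w' $ (p - 1) = of_nat i'"
      "aff (M ^\<^sub>m k') (M ^\<^sub>m k' *\<^sub>v w') = aff (M ^\<^sub>m k) v"
      by (auto simp: G_set_def hol_elem_def \<eta>)
    then have k: "[k' = k] (mod q)" and "M ^\<^sub>m k' *\<^sub>v w' = v"
      using \<eta> by (simp_all add: aff_M_inject)
    then have "M ^\<^sub>m k *\<^sub>v w' = M ^\<^sub>m k *\<^sub>v w"
      using w by (metis M_pow_eq_iff)
    then have "w' = w" using M_pow_inverse_vec(2) g(2) w(1) by metis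
    then have "[i' = i] (mod p)" using g i by (simp flip: of_nat_eq_iff_cong)
    then show "g = hol_elem k i w"
      using g k \<open>w' = w\<close> hol_elem_cong by blast
  qed
qed

sublocale R: regular_holomorph N G_set
  by unfold_locales (rule G_set_regular)

text \<open>The first component of \<open>hol_elem k i w\<close>: coordinates on N in which the
  circle product takes the shape of \<open>hol_elem_mult\<close>.\<close>

abbreviation "point k w \<equiv> aff (M ^\<^sub>m k) (M ^\<^sub>m k *\<^sub>v w)"

lemma circ_point:
  assumes "w \<in> V" "w' \<in> V" "w $ (p - 1) = of_nat i"
  shows "circ R.B (point k w) (point k' w') = point (k + k' * p ^ i) (w + J ^\<^sub>m i *\<^sub>v w')"
proof -
  have reg: "reg_elem G_set (point k w) = hol_elem k i w" if "w \<in> V" "w $ (p - 1) = of_nat i" for k i w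
    using R.reg_elem_fst[of "hol_elem k i w"] that by (auto simp: G_set_def hol_elem_def)
  obtain i' where i': "w' $ (p - 1) = of_nat i'" using surj_of_nat_mod_ring by blast
  show ?thesis
    using reg assms i' by (simp add: brace_of_regular_simps hol_elem_mult) (simp add: hol_elem_def)
qed

subsection \<open>Normal subgroups\<close>

lemma M_vec [simp]: "v \<in> V \<Longrightarrow> M *\<^sub>v v \<in> V"
  using M_pow_vec[of v 1] by simp

lemma M_funpow_vec: "v \<in> V \<Longrightarrow> (((*\<^sub>v) M) ^^ i) v = M ^\<^sub>m i *\<^sub>v v"
proof (induct i arbitrary: v)
  case (Suc i)
  have "((*\<^sub>v) M ^^ Suc i) v = ((*\<^sub>v) M ^^ i) (M *\<^sub>v v)" by (simp add: funpow_swap1)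
  also have "\<dots> = M ^\<^sub>m i *\<^sub>v (M *\<^sub>v v)" using Suc by simp
  also have "\<dots> = M ^\<^sub>m Suc i *\<^sub>v v"
    using Suc(2) by (simp add: assoc_mult_mat_vec[of _ p p _ p])
  finally show ?case .
qed simp

lemma orbit_count:
  assumes "finite S" "S \<subseteq> V" "\<And>v. v \<in> S \<Longrightarrow> M *\<^sub>v v \<in> S" "\<And>v. v \<in> S \<Longrightarrow> M *\<^sub>v v \<noteq> v"
  shows "q dvd card S"
proof (rule prime_dvd_card_fixpoint_free[OF assms(1) _ q_prime])
  show "(((*\<^sub>v) M) ^^ q) v = v" if "v \<in> S" for v
    using M_pow_q_mult[of 1] that assms(2) by (subst M_funpow_vec) auto
qed (use assms in auto)

lemma finite_V: "finite V"
  by simp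

text \<open>The fixed vectors form a subgroup F of order p^d, and d < p because M is not the
  identity. M moves every vector outside F, so q divides p^d (p^(p-d) - 1); hence p divides p - d
  and d = 0.\<close>

lemma M_fixpoint:
  assumes "v \<in> V" "M *\<^sub>v v = v" shows "v = 0\<^sub>v p"
proof -
  interpret VV: comm_group "monoid_vec TYPE('p mod_ring) p" by (rule comm_group_vec)
  define F where "F = {v \<in> V. M *\<^sub>v v = v}"
  have inv: "inv\<^bsub>monoid_vec TYPE('p mod_ring) p\<^esub> v = - v" if "v \<in> V" for v
    using that by (intro VV.inv_equality) (auto simp: monoid_vec_simps)
  have "subgroup F (monoid_vec TYPE('p mod_ring) p)"
    by (rule VV.subgroupI)
      (auto simp: F_def monoid_vec_simps inv mult_mat_vec_zero[OF M_carrier]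
        mult_mat_vec_uminus[OF M_carrier] mult_add_distrib_mat_vec[OF M_carrier] intro!: exI[of _ "0\<^sub>v p"])
  then obtain d where d: "d \<le> p" "card F = p ^ d"
    using vec_subgroup_card[OF p_card] by blast
  have FV: "F \<subseteq> V" by (auto simp: F_def)
  have "d \<noteq> p"
  proof
    assume "d = p"
    then have "F = V" using card_subset_eq[OF finite_V FV] d card_V by simp
    then have "M = 1\<^sub>m p" by (intro mat_eq_one_if_fixes) (auto simp: F_def)
    then have "M ^\<^sub>m 1 = M ^\<^sub>m 0" by simp
    then show False using q_prime unfolding M_pow_eq_iff by (auto simp: cong_def)
  qed
  have "q dvd card (V - F)"
  proof (rule orbit_count)
    fix v assume v: "v \<in> V - F"
    then show "M *\<^sub>v v \<noteq> v" by (auto simp: F_def)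
    \<comment> \<open>Cancelling the invertible M shows that the complement of F is stable under
      M.\<close>
    have "M *\<^sub>v (M *\<^sub>v v) \<noteq> M *\<^sub>v v"
      using v M_pow_inverse_vec(2)[of v 1] M_pow_inverse_vec(2)[of "M *\<^sub>v v" 1] by (auto simp: F_def)
    then show "M *\<^sub>v v \<in> V - F" using v by (auto simp: F_def)
  qed auto
  also have "card (V - F) = p ^ p - p ^ d"
    using card_Diff_subset[of F V] FV finite_V d card_V by (metis finite_subset)
  also have "\<dots> = p ^ d * (p ^ (p - d) - 1)"
    using d by (simp add: diff_mult_distrib2 flip: power_add)
  finally have "q dvd p ^ (p - d) - 1"
    using repunit_facts(2) q_prime prime_dvd_mult_nat prime_dvd_power by blast
  then have "p dvd p - d" by (rule repunit_facts(4))
  then have "d = 0" using d \<open>d \<noteq> p\<close> by (auto dest!: dvd_imp_le)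
  then have "card F = 1" using d by simp
  moreover have "0\<^sub>v p \<in> F" "v \<in> F"
    using assms by (auto simp: F_def mult_mat_vec_zero[OF M_carrier])
  ultimately show ?thesis by (metis card_1_singletonE singletonD)
qed

text \<open>As q is prime, M is itself a power of M^k.\<close>

lemma M_pow_fixpoint:
  assumes v: "v \<in> V" and fixed: "M ^\<^sub>m k *\<^sub>v v = v" and k: "\<not> q dvd k"
  shows "v = 0\<^sub>v p"
proof (rule M_fixpoint[OF v])
  obtain m where "[k * m = 1] (mod q)"
    using k q_prime cong_solve_coprime_nat[of k q] prime_imp_coprime[of q k]
    by (auto simp: algebraic_semidom_class.coprime_commute[of _ q])
  then have M1: "M ^\<^sub>m (k * m) = M ^\<^sub>m 1" by (simp only: M_pow_eq_iff)
  have "M ^\<^sub>m (k * m) *\<^sub>v v = v"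
    using v fixed by (induct m) (auto simp: M_pow_add_vec)
  then show "M *\<^sub>v v = v" unfolding M1 by simp
qed

text \<open>M permutes the nonzero vectors of W without fixed points, so q divides p^d - 1 where p^d
  is the order of W. Hence p divides d, and d is 0 or p.\<close>

lemma M_invariant_trivial:
  assumes W: "subgroup W (monoid_vec TYPE('p mod_ring) p)"
    and inv: "\<And>v. v \<in> W \<Longrightarrow> M *\<^sub>v v \<in> W"
  shows "W = {0\<^sub>v p} \<or> W = V"
proof -
  have WV: "W \<subseteq> V" using subgroup.subset[OF W] by (simp add: monoid_vec_simps)
  have W0: "0\<^sub>v p \<in> W" using subgroup.one_closed[OF W] by (simp add: monoid_vec_simps)
  obtain d where d: "d \<le> p" "card W = p ^ d"
    using vec_subgroup_card[OF p_card W] by blast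
  have "q dvd card (W - {0\<^sub>v p})"
  proof (rule orbit_count)
    fix v assume v: "v \<in> W - {0\<^sub>v p}"
    then show "M *\<^sub>v v \<noteq> v" using M_fixpoint WV by blast
    have "M *\<^sub>v v \<noteq> 0\<^sub>v p"
      using v WV M_pow_inverse_vec(2)[of v 1] mult_mat_vec_zero[OF M_pow_carrier] by auto
    then show "M *\<^sub>v v \<in> W - {0\<^sub>v p}" using v inv by simp
  qed (use WV finite_subset[OF WV finite_V] in auto)
  then have "q dvd p ^ d - 1"
    using d W0 finite_subset[OF WV finite_V] by (simp add: card_Diff_singleton)
  then have "d = 0 \<or> d = p"
    using repunit_facts(4) d by (metis dvd_imp_le le_antisym neq0_conv)
  then show ?thesis
  proof
    assume "d = 0"
    then show ?thesis using d W0 by (metis card_1_singletonE power_0 singletonD)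
  next
    assume "d = p"
    then show ?thesis using card_subset_eq[OF finite_V WV] d card_V by simp
  qed
qed

section \<open>Translations and the normal subgroups of \<open>N\<close>\<close>

definition transl :: "'p mod_ring vec \<Rightarrow> 'p mod_ring mat" where
  "transl v = aff (1\<^sub>m p) v"

lemma transl_eq: "transl v = aff (M ^\<^sub>m 0) v"
  by (simp add: transl_def)

lemma transl_closed [simp]: "v \<in> V \<Longrightarrow> transl v \<in> carrier N"
  unfolding transl_eq by (rule aff_in_N)

lemma transl_mult_aff: "v \<in> V \<Longrightarrow> u \<in> V \<Longrightarrow> transl v * aff (M ^\<^sub>m k) u = aff (M ^\<^sub>m k) (u + v)"
  unfolding transl_eq by (subst aff_M_mult) auto

lemma aff_mult_transl:
  "v \<in> V \<Longrightarrow> u \<in> V \<Longrightarrow> aff (M ^\<^sub>m k) u * transl v = aff (M ^\<^sub>m k) (M ^\<^sub>m k *\<^sub>v v + u)"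
  unfolding transl_eq by (subst aff_M_mult) auto

lemma transl_mult: "v \<in> V \<Longrightarrow> u \<in> V \<Longrightarrow> transl v * transl u = transl (u + v)"
  using transl_mult_aff[of v u 0] by (simp add: transl_def)

lemma transl_zero: "\<one>\<^bsub>N\<^esub> = transl (0\<^sub>v p)"
  by (simp only: transl_eq N_one_aff)

lemma aff_transl: "q dvd k \<Longrightarrow> aff (M ^\<^sub>m k) v = transl v"
  using M_pow_eq_iff[of k 0] by (simp add: transl_def cong_0_iff)

lemma transl_inv:
  assumes "v \<in> V" shows "inv\<^bsub>N\<^esub> transl v = transl (- v)"
proof -
  have "v + - v = 0\<^sub>v p" using assms by (intro eq_vecI) auto
  then show ?thesis
    using assms by (intro N.inv_equality) (simp_all add: N_simps(1) transl_zero transl_mult)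
qed

lemma translations_subgroup:
  assumes I: "subgroup I N"
  shows "subgroup {v \<in> V. transl v \<in> I} (monoid_vec TYPE('p mod_ring) p)"
proof -
  interpret I: subgroup I N by (rule I)
  interpret VV: comm_group "monoid_vec TYPE('p mod_ring) p" by (rule comm_group_vec)
  have inv: "inv\<^bsub>monoid_vec TYPE('p mod_ring) p\<^esub> v = - v" if "v \<in> V" for v
    using that by (intro VV.inv_equality) (auto simp: monoid_vec_simps)
  show ?thesis
  proof (rule VV.subgroupI)
    have "0\<^sub>v p \<in> {v \<in> V. transl v \<in> I}" using I.one_closed by (simp add: transl_zero)
    then show "{v \<in> V. transl v \<in> I} \<noteq> {}" by blast
    show "v \<otimes>\<^bsub>monoid_vec TYPE('p mod_ring) p\<^esub> w \<in> {v \<in> V. transl v \<in> I}"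
      if "v \<in> {v \<in> V. transl v \<in> I}" "w \<in> {v \<in> V. transl v \<in> I}" for v w
      using that I.m_closed[of "transl w" "transl v"]
      by (simp add: monoid_vec_simps N_simps(1) transl_mult)
    show "inv\<^bsub>monoid_vec TYPE('p mod_ring) p\<^esub> v \<in> {v \<in> V. transl v \<in> I}"
      if "v \<in> {v \<in> V. transl v \<in> I}" for v
      using that I.m_inv_closed[of "transl v"] by (simp add: inv transl_inv)
  qed (auto simp: monoid_vec_simps)
qed

text \<open>Conjugating by the linear map M turns translation by v into translation by Mv, so the
  translations in I form an M-invariant subgroup of V.\<close>

lemma translations_cases:
  assumes I: "I \<lhd> N"
  shows "{v \<in> V. transl v \<in> I} = {0\<^sub>v p} \<or> {v \<in> V. transl v \<in> I} = V"
proof (rule M_invariant_trivial)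
  show "subgroup {v \<in> V. transl v \<in> I} (monoid_vec TYPE('p mod_ring) p)"
    by (rule translations_subgroup[OF normal_imp_subgroup[OF I]])
  fix v assume v: "v \<in> {v \<in> V. transl v \<in> I}"
  have "transl (M *\<^sub>v v) \<in> I"
  proof (rule normal_conj_mem[OF I, of "aff (M ^\<^sub>m 1) (0\<^sub>v p)" "transl v"])
    have "aff (M ^\<^sub>m 1) (0\<^sub>v p) * transl v = aff (M ^\<^sub>m 1) (M ^\<^sub>m 1 *\<^sub>v v + 0\<^sub>v p)"
      using v by (intro aff_mult_transl) auto
    moreover have "transl (M *\<^sub>v v) * aff (M ^\<^sub>m 1) (0\<^sub>v p) = aff (M ^\<^sub>m 1) (0\<^sub>v p + M *\<^sub>v v)"
      using v by (intro transl_mult_aff) auto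
    ultimately show "aff (M ^\<^sub>m 1) (0\<^sub>v p) \<otimes>\<^bsub>N\<^esub> transl v =
        transl (M *\<^sub>v v) \<otimes>\<^bsub>N\<^esub> aff (M ^\<^sub>m 1) (0\<^sub>v p)"
      using v by (simp add: N_simps(1))
    show "aff (M ^\<^sub>m 1) (0\<^sub>v p) \<in> carrier N" by (rule aff_in_N) simp
  qed (use v in auto)
  then show "M *\<^sub>v v \<in> {v \<in> V. transl v \<in> I}" using v by simp
qed

text \<open>This is the commutator of \<open>transl u\<close> with the given element of I; v drops
  out because translations commute.\<close>

lemma commutator_mem:
  assumes I: "I \<lhd> N" and h: "aff (M ^\<^sub>m k) v \<in> I" and v: "v \<in> V" and u: "u \<in> V"
  shows "transl (u + - (M ^\<^sub>m k *\<^sub>v u)) \<in> I"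
proof -
  interpret I: normal I N by (rule I)
  let ?r = "u + - (M ^\<^sub>m k *\<^sub>v u)"
  have r: "?r \<in> V" using u by simp
  have hN: "aff (M ^\<^sub>m k) v \<in> carrier N" using v by (rule aff_in_N)
  have "transl ?r \<otimes>\<^bsub>N\<^esub> aff (M ^\<^sub>m k) v \<in> I"
  proof (rule normal_conj_mem[OF I, of "transl u" "aff (M ^\<^sub>m k) v"])
    have "M ^\<^sub>m k *\<^sub>v u + (v + ?r) = v + u"
      using u v M_pow_vec[OF u, of k] by (intro eq_vecI) (auto simp del: index_mult_mat_vec)
    then show "transl u \<otimes>\<^bsub>N\<^esub> aff (M ^\<^sub>m k) v = transl ?r \<otimes>\<^bsub>N\<^esub> aff (M ^\<^sub>m k) v \<otimes>\<^bsub>N\<^esub> transl u"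
      using u v r by (simp add: N_simps(1) transl_mult_aff aff_mult_transl)
  qed (use h hN u r in auto)
  then have "transl ?r \<otimes>\<^bsub>N\<^esub> aff (M ^\<^sub>m k) v \<otimes>\<^bsub>N\<^esub> inv\<^bsub>N\<^esub> aff (M ^\<^sub>m k) v \<in> I"
    using h by blast
  then show ?thesis using hN r by (simp add: N.m_assoc)
qed

text \<open>If I has no nontrivial translation, an element outside V would yield one by a
  commutator, so I is trivial. Otherwise I contains V, and the quotient of N by V is cyclic of prime
  order q.\<close>

lemma normal_subgroup_cases:
  assumes I: "I \<lhd> N"
  shows "I = {\<one>\<^bsub>N\<^esub>} \<or> I = transl ` V \<or> I = carrier N"
proof -
  interpret I: normal I N by (rule I)
  have I_cases: thesis if "x \<in> I" "\<And>k v. x = aff (M ^\<^sub>m k) v \<Longrightarrow> v \<in> V \<Longrightarrow> thesis" for x thesis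
    using that(2) by (rule N_cases[OF I.mem_carrier[OF that(1)]])
  show ?thesis
  proof (cases "{v \<in> V. transl v \<in> I} = V")
    case False
    then have W0: "v = 0\<^sub>v p" if "v \<in> V" "transl v \<in> I" for v
      using translations_cases[OF I] that by blast
    have "x = \<one>\<^bsub>N\<^esub>" if xI: "x \<in> I" for x
    proof -
      obtain k v where x: "x = aff (M ^\<^sub>m k) v" "v \<in> V"
        using I_cases[OF xI] .
      have "q dvd k"
      proof (rule ccontr)
        assume k: "\<not> q dvd k"
        \<comment> \<open>Any nonzero vector serves, since M^k fixes none of them.\<close>
        let ?u = "e_vec p p :: 'p mod_ring vec"
        have u: "?u \<in> V" by (rule e_vec_last)
        have "?u + - (M ^\<^sub>m k *\<^sub>v ?u) = 0\<^sub>v p"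
          using commutator_mem[OF I] xI x u by (intro W0) auto
        moreover have "(?u + - (M ^\<^sub>m k *\<^sub>v ?u)) + M ^\<^sub>m k *\<^sub>v ?u = ?u"
          using u M_pow_vec[OF u, of k] by (intro eq_vecI) (auto simp del: index_mult_mat_vec)
        ultimately have "M ^\<^sub>m k *\<^sub>v ?u = ?u"
          using u by simp
        then have "?u = 0\<^sub>v p" by (rule M_pow_fixpoint[OF u _ k])
        then show False using e_vec_last(2) p_ge_2 by simp
      qed
      then have "x = transl v" unfolding x by (rule aff_transl)
      then show ?thesis using W0[OF x(2)] xI by (simp add: transl_zero)
    qed
    then show ?thesis using I.one_closed by blast
  next
    case True
    then have transI: "transl v \<in> I" if "v \<in> V" for v using that by blast
    show ?thesis
    proof (cases "\<exists>k v. \<not> q dvd k \<and> v \<in> V \<and> aff (M ^\<^sub>m k) v \<in> I")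
      case True
      then obtain k v where k: "\<not> q dvd k" "v \<in> V" "aff (M ^\<^sub>m k) v \<in> I" by blast
      \<comment> \<open>Since I contains all translations, membership in I depends on the linear
        part alone.\<close>
      have change: "aff (M ^\<^sub>m l) u \<in> I" if "aff (M ^\<^sub>m l) w \<in> I" "u \<in> V" "w \<in> V" for l u w
      proof -
        have r: "u + - w \<in> V" using that by simp
        have "w + (u + - w) = u" using that by (intro eq_vecI) auto
        then show ?thesis
          using I.m_closed[OF transI[OF r] that(1)] transl_mult_aff[OF r that(3), of l]
          by (simp only: N_simps(1))
      qed
      have pow: "aff (M ^\<^sub>m (k * j)) (0\<^sub>v p) \<in> I" for j
      proof (induct j)
        case 0
        show ?case using transI[of "0\<^sub>v p"] by (simp add: transl_def)
      next
        case (Suc j)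
        have "aff (M ^\<^sub>m k) (0\<^sub>v p) \<in> I" using change[OF k(3) _ k(2)] by simp
        from I.m_closed[OF this Suc] show ?case
          by (simp add: N_simps(1) aff_M_mult mult_mat_vec_zero[OF M_pow_carrier])
      qed
      obtain m where m: "[k * m = 1] (mod q)"
        using k q_prime cong_solve_coprime_nat[of k q] prime_imp_coprime[of q k]
        by (auto simp: algebraic_semidom_class.coprime_commute[of _ q])
      have "x \<in> I" if xN: "x \<in> carrier N" for x
      proof -
        obtain l u where x: "x = aff (M ^\<^sub>m l) u" "u \<in> V" using N_cases[OF xN] .
        have "[k * m * l = 1 * l] (mod q)" using m by (rule cong_scalar_right)
        then have "M ^\<^sub>m (k * (m * l)) = M ^\<^sub>m l" unfolding M_pow_eq_iff by (simp add: mult.assoc)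
        then show ?thesis using change[OF pow[of "m * l"] x(2)] x(1) by simp
      qed
      then show ?thesis using I.subset by blast
    next
      case False
      have "x \<in> transl ` V" if xI: "x \<in> I" for x
      proof -
        obtain k v where x: "x = aff (M ^\<^sub>m k) v" "v \<in> V"
          using I_cases[OF xI] .
        then have "q dvd k" using xI False by blast
        then show ?thesis using x aff_transl by blast
      qed
      then show ?thesis using transI by blast
    qed
  qed
qed

text \<open>The points \<open>point 1 (0\<^sub>v p)\<close> and \<open>transl (e_vec p p)\<close>
  correspond to X and Z. Writing XZ = hX with h a translation by v, comparison of translation parts
  forces v = e_p, hence i = 1; comparison of exponents of M then gives that q divides p - 1.\<close>

lemma translations_not_normal: "\<not> transl ` V \<lhd> circ_group R.B"
proof
  assume "transl ` V \<lhd> circ_group R.B"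
  moreover have "point 1 (0\<^sub>v p) \<in> carrier (circ_group R.B)"
    unfolding circ_group_simps brace_of_regular_simps by (intro aff_in_N M_pow_vec zero_carrier_vec)
  moreover have "transl (e_vec p p) \<in> transl ` V" using e_vec_last(1) by (rule imageI)
  ultimately obtain h where h: "h \<in> transl ` V"
    "point 1 (0\<^sub>v p) \<otimes>\<^bsub>circ_group R.B\<^esub> transl (e_vec p p) = h \<otimes>\<^bsub>circ_group R.B\<^esub> point 1 (0\<^sub>v p)"
    by (rule normal_commute)
  then obtain v where v: "h = transl v" "v \<in> V" by blast
  \<comment> \<open>The representative below p is chosen so that i congruent to 1 modulo p will mean
    i = 1.\<close>
  obtain i where i: "i < p" "v $ (p - 1) = of_nat i"
    using surj_of_nat_mod_ring p_card by metis
  have pt: "transl u = point 0 u" if "u \<in> V" for u using that by (simp add: transl_def)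
  have "circ R.B (point 1 (0\<^sub>v p)) (point 0 (e_vec p p)) =
      point (1 + 0 * p ^ 0) (0\<^sub>v p + J ^\<^sub>m 0 *\<^sub>v e_vec p p)"
    by (rule circ_point) (use e_vec_last p_ge_2 in auto)
  moreover have "0\<^sub>v p + J ^\<^sub>m 0 *\<^sub>v e_vec p p = e_vec p p"
    using e_vec_last by simp
  moreover have "circ R.B (point 0 v) (point 1 (0\<^sub>v p)) =
      point (0 + 1 * p ^ i) (v + J ^\<^sub>m i *\<^sub>v 0\<^sub>v p)"
    by (rule circ_point) (use v i in auto)
  moreover have "v + J ^\<^sub>m i *\<^sub>v 0\<^sub>v p = v"
    using v by (simp add: mult_mat_vec_zero[OF jordan_block_pow_carrier])
  ultimately have "point 1 (e_vec p p) = point (p ^ i) v"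
    using h(2) unfolding v(1) circ_group_simps pt[OF v(2)] pt[OF e_vec_last(1)] by simp
  then have 1: "[1 = p ^ i] (mod q)" and 2: "M ^\<^sub>m 1 *\<^sub>v e_vec p p = M ^\<^sub>m (p ^ i) *\<^sub>v v"
    using v e_vec_last by (simp_all add: aff_M_inject del: pow_mat.simps One_nat_def)
  have "M ^\<^sub>m (p ^ i) = M ^\<^sub>m 1" using 1 by (simp only: M_pow_eq_iff cong_sym_eq)
  then have "v = e_vec p p"
    using 2 v e_vec_last M_pow_inverse_vec(2) by metis
  then have "[i = 1] (mod p)"
    using i e_vec_last of_nat_eq_iff_cong[of i 1] by simp
  then have "i = 1" using i p_ge_2 cong_less_modulus_unique_nat[of i 1 p] by simp
  then have "q dvd p - 1" using 1 p_ge_2 by (simp add: cong_sym_eq cong_altdef_nat)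
  then show False using repunit_facts(3) by blast
qed

lemma B_simple: "simple_skew_brace R.B"
  unfolding simple_skew_brace_def
proof (intro conjI allI impI)
  show "skew_brace R.B" by (rule R.brace_skew_brace)
  have "q \<le> p ^ p * q" using p_ge_2 by simp
  then have "1 < card (carrier N)" unfolding card_N using prime_ge_2_nat[OF q_prime] by linarith
  then have "carrier N \<noteq> {\<one>\<^bsub>N\<^esub>}" by (metis card_1_singleton_iff One_nat_def less_irrefl)
  then show "carrier R.B \<noteq> {\<one>\<^bsub>R.B\<^esub>}" by (simp only: brace_of_regular_simps not_False_eq_True)
next
  fix I assume "brace_ideal I R.B"
  then have I: "I \<lhd> R.B" "I \<lhd> circ_group R.B" by (auto simp: brace_ideal_def)
  \<comment> \<open>The identity map carries normality from the brace record to N itself.\<close>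
  have "id ` I \<lhd> N"
    using iso_normal_subgroup[OF N.same_operations_group(3) N.same_operations_group(1) N.group_axioms I(1)]
    by (simp add: brace_of_regular_simps)
  then have "I \<lhd> N" by simp
  from normal_subgroup_cases[OF this] show "I = {\<one>\<^bsub>R.B\<^esub>} \<or> I = carrier R.B"
    using translations_not_normal I(2) by (metis brace_of_regular_simps(1,3))
qed

end

theorem theorem3p13:
  fixes p q n :: nat and M :: "'p::prime_card mod_ring mat"
  assumes "p = CARD('p)" and "Factorial_Ring.prime p" and "Factorial_Ring.prime q"
    and "n = p ^ p * q"
    and "q dvd (p ^ p - 1) div (p - 1)"
    and "M \<in> carrier (GL p)" and "group.ord (GL p) M = q"
    and "jordan_block p 1 * M * inv\<^bsub>GL p\<^esub> (jordan_block p 1) = M ^\<^sub>m p"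
  shows "regular_subgroup (G_sub p q M) (N_grp p q M) \<and>
    (let B = brace_of_regular (N_grp p q M) (G_sub p q M) in
       simple_skew_brace B \<and> Coset.order B = n \<and>
       B \<cong> N_grp p q M \<and>
       circ_group B \<cong> (Hol (N_grp p q M))\<lparr>carrier := G_sub p q M\<rparr>)"
proof -
  interpret jordan_brace p q M
    using assms by unfold_locales
  have "R.B \<cong> N"
    by (rule is_isoI[OF N.same_operations_group(3)]) (simp_all add: brace_of_regular_simps)
  moreover have "Coset.order R.B = n"
    using card_N assms by (simp add: Coset.order_def brace_of_regular_simps)
  ultimately show ?thesis
    unfolding Let_def G_sub_eq
    using G_set_regular B_simple R.circ_group_iso by blast
qed

end
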